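(* Let $\mathcal{M}$ be a 3-dimensional manifold with local coordinates $x=(x^1,x^2,x^3)$ and consider the driftless $x$-flat system $$\dot x = g_1(x)u^1+g_2(x)u^2,\qquad x(0)=x_0,$$ with smooth vector fields $g_1,g_2$ and $x$-flat output $\varphi=(\varphi^1,\varphi^2)$, where $L_{g_2}\varphi^i=0$ for $i=1,2$. Let $\mathcal{I}=[0,T]$, let $y_d\in C^\infty(\mathcal{I},\mathbb{R}^2)$, and put $e^i=y_d^i-\varphi^i(x)$, so that $\dot e^i=\dot y_d^i-L_{g_1}\varphi^i\,u^1$. Let $\bar Q=[\bar Q_{ij}]$, $Q=[Q_{ij}]$, $M=[M_{ij}]$ be constant symmetric positive definite $2\times2$ matrices, and let $[M^{lm}]=M^{-1}$. Consider the fixed-time, free-endpoint optimal control problem of minimizing $$J(u)=\tfrac12 e^i\bar Q_{ij}e^j\Big|_{t=T}+\int_0^T\tfrac12\big(e^iQ_{ij}e^j+\dot e^iM_{ij}\dot e^j\big)\,dt$$ subject to the system dynamics and the bounds $|u^a|\le u^a_{\max}$, $a=1,2$. Assume that the weights satisfy $$Q_{ij}=\bar Q_{il}M^{lm}\bar Q_{mj},\qquad\text{i.e. } Q=\bar QM^{-1}\bar Q .$$ Then on the singular arc the components of the costate $\lambda$ of Pontryagin's maximum principle are given by $$\lambda_k=-e^i\bar Q_{ij}\,\partial_{x^k}\varphi^j=\dot e^iM_{ij}\,\partial_{x^k}\varphi^j,\qquad k=1,2,3 .$$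
   Context: The Einstein summation convention is used; $L_g\varphi=g^k\partial_{x^k}\varphi$ is the Lie derivative and $[g_1,g_2]^k=g_1^l\partial_{x^l}g_2^k-g_2^l\partial_{x^l}g_1^k$ is the Lie bracket. Flatness. A system $\dot x=f(x,u)$ with $m$ inputs is $x$-flat if there is an $m$-tuple $y=\varphi(x)$ (the $x$-flat output) such that $(x,u)=F(y,\dot y,\dots,y^{(r)})$ for some smooth $F$. All considerations are local. For the system considered here, $x$-flatness is equivalent to local equivalence, by a state transformation and a static input transformation, to the chained form $\dot z^1=v^1,\ \dot z^2=z^3v^1,\ \dot z^3=v^2$ with flat output $(z^1,z^2)$. After a static input transformation it is assumed that $L_{g_2}\varphi^i=0$, $i=1,2$. Flatness then gives that $g_1,g_2,[g_1,g_2]$ span the tangent space and that $$\det\begin{bmatrix}L_{g_1}\varphi^1&L_{[g_1,g_2]}\varphi^1\\ L_{g_1}\varphi^2&L_{[g_1,g_2]}\varphi^2\end{bmatrix}\neq0 .$$ Necessary conditions. The Hamiltonian is $H=\tfrac12(e^iQ_{ij}e^j+\dot e^iM_{ij}\dot e^j)+\lambda_lg_a^lu^a$. The costate satisfies $$\dot\lambda_k=e^iQ_{ij}\partial_{x^k}\varphi^j+\dot e^iM_{ij}\,\partial_{x^k}(L_{g_1}\varphi^j)\,u^1-\lambda_l\,\partial_{x^k}g_a^l\,u^a,\qquad \lambda_k\big|_{t=T}=-e^i\bar Q_{ij}\partial_{x^k}\varphi^j\big|_{t=T}.$$ Put $\xi_1=\partial_{u^1}H=-\dot e^iM_{ij}L_{g_1}\varphi^j+\lambda_lg_1^l$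 and $\xi_2=\partial_{u^2}H=\lambda_lg_2^l$. The input $u^1$ is regular (it is determined by $\xi_1=0$, with $\partial^2_{u^1u^1}H>0$), while $H$ is affine in $u^2$, so $u^2$ is singular. Singular arc. A singular arc is a nontrivial time interval $\mathcal{I}_s\subseteq\mathcal{I}$ on which $\xi_1=0$, $\xi_2\equiv0$ and the successive time derivatives of $\xi_2$ vanish; in particular $\dot\xi_2=\big[-\dot e^iM_{ij}L_{[g_1,g_2]}\varphi^j+\lambda_l[g_1,g_2]^l\big]u^1=0$, which is understood as the vanishing of the bracket (i.e. $u^1\neq0$).
   Formalization: The equality of the costate with −e^i Q̄_ij ∂φ^j is proved for singular arcs that reach the final time T (T in the closure of the arc); it can fail on an arc followed by a bang arc. The formula with ė^i M_ij ∂φ^j is proved on every singular arc. *)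

theory Defs
  imports "HOL-Analysis.Analysis"
begin

section \<open>Partial derivatives, Lie derivatives and smoothness\<close>

definition partial_deriv :: "'n::finite \<Rightarrow> (real^'n \<Rightarrow> 'b::real_normed_vector) \<Rightarrow> real^'n \<Rightarrow> 'b" where
  "partial_deriv k f x = frechet_derivative f (at x) (axis k 1)"

text \<open>For vector-valued \<open>f\<close> the Lie derivative acts on every component.\<close>

definition lie_deriv :: "(real^'n \<Rightarrow> real^'n) \<Rightarrow> (real^'n \<Rightarrow> 'b::real_normed_vector) \<Rightarrow> real^'n \<Rightarrow> 'b" where
  "lie_deriv g f x = (\<Sum>k\<in>UNIV. g x $ k *\<^sub>R partial_deriv k f x)"

definition lie_bracket :: "(real^'n \<Rightarrow> real^'n) \<Rightarrow> (real^'n \<Rightarrow> real^'n) \<Rightarrow> real^'n \<Rightarrow> real^'n" where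
  "lie_bracket g h x = lie_deriv g h x - lie_deriv h g x"

primrec Ck_on :: "nat \<Rightarrow> (real^'n \<Rightarrow> 'b::real_normed_vector) \<Rightarrow> (real^'n) set \<Rightarrow> bool" where
  "Ck_on 0 f X \<longleftrightarrow> continuous_on X f"
| "Ck_on (Suc n) f X \<longleftrightarrow> f differentiable_on X \<and> (\<forall>k. Ck_on n (partial_deriv k f) X)"

text \<open>Only used for open \<open>X\<close>, since \<^const>\<open>partial_deriv\<close> is two-sided.\<close>

definition smooth_on :: "(real^'n \<Rightarrow> 'b::real_normed_vector) \<Rightarrow> (real^'n) set \<Rightarrow> bool" where
  "smooth_on f X \<longleftrightarrow> (\<forall>n. Ck_on n f X)"

text \<open>\<open>Y k\<close> is the \<open>k\<close>-th derivative of the curve \<open>Y 0\<close> on \<open>J\<close>;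
  one-sided at endpoints of \<open>J\<close> that belong to \<open>J\<close>.\<close>

definition curve_derivs :: "real set \<Rightarrow> (nat \<Rightarrow> real \<Rightarrow> 'a::real_normed_vector) \<Rightarrow> bool" where
  "curve_derivs J Y \<longleftrightarrow> (\<forall>k. \<forall>t\<in>J. (Y k has_vector_derivative Y (Suc k) t) (at t within J))"

definition smooth_curve_on :: "real set \<Rightarrow> (real \<Rightarrow> 'a::real_normed_vector) \<Rightarrow> bool" where
  "smooth_curve_on J y \<longleftrightarrow> (\<exists>Y. curve_derivs J Y \<and> (\<forall>t\<in>J. Y 0 t = y t))"


section \<open>Flatness\<close>

text \<open>
  A jet \<open>(y, y', y'', ...)\<close> of a curve in \<open>\<real>\<^sup>m\<close> is encoded as a sequence \<open>nat \<Rightarrow> real^'m\<close> carrying the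
  product topology.  A function of \<open>(y, ..., y\<^sup>(\<^sup>r\<^sup>))\<close> is a function of the sequence that
  only depends on the entries \<open>0, ..., r\<close>; its smoothness is expressed by iterated partial
  derivatives with respect to the coordinates of the entries.
\<close>

definition jet_move :: "nat \<Rightarrow> 'm::finite \<Rightarrow> (nat \<Rightarrow> real^'m) \<Rightarrow> real \<Rightarrow> (nat \<Rightarrow> real^'m)" where
  "jet_move k i \<eta> s = \<eta>(k := \<eta> k + s *\<^sub>R axis i 1)"

definition jet_partial ::
  "nat \<Rightarrow> 'm::finite \<Rightarrow> ((nat \<Rightarrow> real^'m) \<Rightarrow> 'b::real_normed_vector) \<Rightarrow> (nat \<Rightarrow> real^'m) \<Rightarrow> 'b" where
  "jet_partial k i F \<eta> = vector_derivative (\<lambda>s. F (jet_move k i \<eta> s)) (at 0)"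

primrec jet_Ck_on ::
  "nat \<Rightarrow> ((nat \<Rightarrow> real^'m) \<Rightarrow> 'b::real_normed_vector) \<Rightarrow> (nat \<Rightarrow> real^'m) set \<Rightarrow> bool" where
  "jet_Ck_on 0 F W \<longleftrightarrow> continuous_on W F"
| "jet_Ck_on (Suc n) F W \<longleftrightarrow> continuous_on W F \<and>
     (\<forall>k i. (\<forall>\<eta>\<in>W. (\<lambda>s. F (jet_move k i \<eta> s)) differentiable (at 0)) \<and> jet_Ck_on n (jet_partial k i F) W)"

definition jet_smooth_on ::
  "((nat \<Rightarrow> real^'m) \<Rightarrow> 'b::real_normed_vector) \<Rightarrow> (nat \<Rightarrow> real^'m) set \<Rightarrow> bool" where
  "jet_smooth_on F W \<longleftrightarrow> (\<forall>n. jet_Ck_on n F W)"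

definition jet_order_le :: "nat \<Rightarrow> ((nat \<Rightarrow> real^'m) \<Rightarrow> 'b) \<Rightarrow> (nat \<Rightarrow> real^'m) set \<Rightarrow> bool" where
  "jet_order_le r F W \<longleftrightarrow>
     (\<forall>\<eta> \<eta>'. (\<forall>k\<le>r. \<eta> k = \<eta>' k) \<longrightarrow> (\<eta> \<in> W \<longleftrightarrow> \<eta>' \<in> W) \<and> F \<eta> = F \<eta>')"

definition ode_solution_on ::
  "(real^'n \<Rightarrow> real^'m \<Rightarrow> real^'n) \<Rightarrow> real set \<Rightarrow> (real \<Rightarrow> real^'n) \<Rightarrow> (real \<Rightarrow> real^'m) \<Rightarrow> bool" where
  "ode_solution_on f J x u \<longleftrightarrow> (\<forall>t\<in>J. (x has_vector_derivative f (x t) (u t)) (at t within J))"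

text \<open>
  \<open>y = \<phi>(x)\<close> is a flat output: locally around every state, \<open>(x, u) = F(y, y', ..., y\<^sup>(\<^sup>r\<^sup>))\<close>.
  The map \<open>F\<close> lives on an open set \<open>W\<close> of jets (for the chained form, \<open>y\<^sup>1' \<noteq> 0\<close>) that contains a
  jet over the given state.  The last clause says that \<open>y\<close> is free, i.e. satisfies no
  differential equation by itself: every curve \<open>y\<close> with jets in \<open>W\<close> comes from a trajectory of the
  system, so that \<open>F\<close> parametrizes the trajectories by the curves \<open>y\<close>.
\<close>

definition x_flat_output ::
  "(real^'n \<Rightarrow> real^'m \<Rightarrow> real^'n) \<Rightarrow> (real^'n \<Rightarrow> real^'m) \<Rightarrow> (real^'n) set \<Rightarrow> bool" where
  "x_flat_output f \<phi> X \<longleftrightarrow> smooth_on \<phi> X \<and>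
    (\<forall>p\<in>X. \<exists>U r W (F :: (nat \<Rightarrow> real^'m) \<Rightarrow> (real^'n) \<times> (real^'m)).
       open U \<and> p \<in> U \<and> U \<subseteq> X \<and>
       open W \<and> jet_order_le r F W \<and> jet_smooth_on F W \<and> (\<exists>\<eta>\<in>W. fst (F \<eta>) = p) \<and>
       (\<forall>J x u Y. open J \<and> smooth_curve_on J u \<and> ode_solution_on f J x u \<and> x ` J \<subseteq> U \<and>
           curve_derivs J Y \<and> (\<forall>t\<in>J. Y 0 t = \<phi> (x t) \<and> (\<lambda>k. Y k t) \<in> W)
           \<longrightarrow> (\<forall>t\<in>J. (x t, u t) = F (\<lambda>k. Y k t))) \<and>
       (\<forall>J Y. open J \<and> curve_derivs J Y \<and> (\<forall>t\<in>J. (\<lambda>k. Y k t) \<in> W)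
           \<longrightarrow> (let x = (\<lambda>t. fst (F (\<lambda>k. Y k t))); u = (\<lambda>t. snd (F (\<lambda>k. Y k t)))
                in x ` J \<subseteq> U \<and> ode_solution_on f J x u \<and> (\<forall>t\<in>J. \<phi> (x t) = Y 0 t))))"


section \<open>Optimal control problems and Pontryagin's maximum principle\<close>

text \<open>Controls are piecewise continuous (and bounded, by the input constraints); the state is
  continuous and satisfies the differential equation off a finite set of times.\<close>

definition admissible_process ::
  "(real^'n \<Rightarrow> real^'m \<Rightarrow> real^'n) \<Rightarrow> (real^'n) set \<Rightarrow> real^'n \<Rightarrow> real \<Rightarrow> real^'m \<Rightarrow>
   (real \<Rightarrow> real^'n) \<Rightarrow> (real \<Rightarrow> real^'m) \<Rightarrow> bool" where
  "admissible_process f X x0 T umax x u \<longleftrightarrow>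
     (\<exists>S. finite S \<and> continuous_on ({0..T} - S) u \<and>
        (\<forall>t\<in>{0..T} - S. (x has_vector_derivative f (x t) (u t)) (at t within {0..T}))) \<and>
     (\<forall>t\<in>{0..T}. \<forall>a. \<bar>u t $ a\<bar> \<le> umax $ a) \<and>
     continuous_on {0..T} x \<and> x ` {0..T} \<subseteq> X \<and> x 0 = x0"

definition cost ::
  "(real \<Rightarrow> real^'n \<Rightarrow> real^'m \<Rightarrow> real) \<Rightarrow> (real^'n \<Rightarrow> real) \<Rightarrow> real \<Rightarrow>
   (real \<Rightarrow> real^'n) \<Rightarrow> (real \<Rightarrow> real^'m) \<Rightarrow> real" where
  "cost run term T x u = term (x T) + integral {0..T} (\<lambda>t. run t (x t) (u t))"

definition optimal_process ::
  "(real^'n \<Rightarrow> real^'m \<Rightarrow> real^'n) \<Rightarrow> (real \<Rightarrow> real^'n \<Rightarrow> real^'m \<Rightarrow> real) \<Rightarrow> (real^'n \<Rightarrow> real) \<Rightarrow>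
   (real^'n) set \<Rightarrow> real^'n \<Rightarrow> real \<Rightarrow> real^'m \<Rightarrow>
   (real \<Rightarrow> real^'n) \<Rightarrow> (real \<Rightarrow> real^'m) \<Rightarrow> bool" where
  "optimal_process f run term X x0 T umax x u \<longleftrightarrow>
     admissible_process f X x0 T umax x u \<and>
     (\<forall>x' u'. admissible_process f X x0 T umax x' u' \<longrightarrow> cost run term T x u \<le> cost run term T x' u')"

definition hamiltonian ::
  "(real^'n \<Rightarrow> real^'m \<Rightarrow> real^'n) \<Rightarrow> (real \<Rightarrow> real^'n \<Rightarrow> real^'m \<Rightarrow> real) \<Rightarrow>
   real \<Rightarrow> real^'n \<Rightarrow> real^'m \<Rightarrow> real^'n \<Rightarrow> real" where
  "hamiltonian f run t x u l = run t x u + l \<bullet> f x u"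

text \<open>The free endpoint makes the problem normal, so the cost enters with multiplier one; with this
  sign convention the input minimizes the Hamiltonian.\<close>

definition pmp_costate ::
  "(real^'n \<Rightarrow> real^'m \<Rightarrow> real^'n) \<Rightarrow> (real \<Rightarrow> real^'n \<Rightarrow> real^'m \<Rightarrow> real) \<Rightarrow> (real^'n \<Rightarrow> real) \<Rightarrow>
   real \<Rightarrow> real^'m \<Rightarrow> (real \<Rightarrow> real^'n) \<Rightarrow> (real \<Rightarrow> real^'m) \<Rightarrow> (real \<Rightarrow> real^'n) \<Rightarrow> bool" where
  "pmp_costate f run term T umax x u l \<longleftrightarrow>
     continuous_on {0..T} l \<and>
     (\<exists>S. finite S \<and> (\<forall>t\<in>{0..T} - S.
        (\<forall>k. ((\<lambda>s. l s $ k) has_real_derivative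
               - partial_deriv k (\<lambda>z. hamiltonian f run t z (u t) (l t)) (x t)) (at t within {0..T})) \<and>
        (\<forall>v. (\<forall>a. \<bar>v $ a\<bar> \<le> umax $ a) \<longrightarrow>
           hamiltonian f run t (x t) (u t) (l t) \<le> hamiltonian f run t (x t) v (l t)))) \<and>
     (\<forall>k. l T $ k = partial_deriv k term (x T))"


section \<open>The tracking problem\<close>

definition sym_pos_def :: "real^'n^'n \<Rightarrow> bool" where
  "sym_pos_def A \<longleftrightarrow> transpose A = A \<and> (\<forall>v. v \<noteq> 0 \<longrightarrow> v \<bullet> (A *v v) > 0)"

definition driftless ::
  "(real^'n \<Rightarrow> real^'n) \<Rightarrow> (real^'n \<Rightarrow> real^'n) \<Rightarrow> real^'n \<Rightarrow> real^2 \<Rightarrow> real^'n" where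
  "driftless g1 g2 x u = u $ 1 *\<^sub>R g1 x + u $ 2 *\<^sub>R g2 x"

definition track_err :: "(real^'n \<Rightarrow> real^2) \<Rightarrow> (real \<Rightarrow> real^2) \<Rightarrow> real \<Rightarrow> real^'n \<Rightarrow> real^2" where
  "track_err \<phi> yd t x = yd t - \<phi> x"

text \<open>The time derivative of the tracking error as a function of \<open>(t, x, u)\<close>, using that the Lie
  derivative of \<open>\<phi>\<close> along \<open>g2\<close> vanishes.\<close>

definition track_err_rate ::
  "(real^'n \<Rightarrow> real^'n) \<Rightarrow> (real^'n \<Rightarrow> real^2) \<Rightarrow> (real \<Rightarrow> real^2) \<Rightarrow> real \<Rightarrow>
   real \<Rightarrow> real^'n \<Rightarrow> real^2 \<Rightarrow> real^2" where
  "track_err_rate g1 \<phi> yd T t x u =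
     vector_derivative yd (at t within {0..T}) - u $ 1 *\<^sub>R lie_deriv g1 \<phi> x"

definition track_running_cost ::
  "(real^'n \<Rightarrow> real^'n) \<Rightarrow> (real^'n \<Rightarrow> real^2) \<Rightarrow> (real \<Rightarrow> real^2) \<Rightarrow> real \<Rightarrow> real^2^2 \<Rightarrow> real^2^2 \<Rightarrow>
   real \<Rightarrow> real^'n \<Rightarrow> real^2 \<Rightarrow> real" where
  "track_running_cost g1 \<phi> yd T Q M t x u =
     (1/2) * (track_err \<phi> yd t x \<bullet> (Q *v track_err \<phi> yd t x) +
              track_err_rate g1 \<phi> yd T t x u \<bullet> (M *v track_err_rate g1 \<phi> yd T t x u))"

definition track_terminal_cost ::
  "(real^'n \<Rightarrow> real^2) \<Rightarrow> (real \<Rightarrow> real^2) \<Rightarrow> real \<Rightarrow> real^2^2 \<Rightarrow> real^'n \<Rightarrow> real" where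
  "track_terminal_cost \<phi> yd T Qbar x = (1/2) * (track_err \<phi> yd T x \<bullet> (Qbar *v track_err \<phi> yd T x))"

text \<open>\<open>\<xi>\<^sub>a\<close> is the partial derivative of the Hamiltonian with respect to the input \<open>u\<^sup>a\<close>.\<close>

definition switching_fun ::
  "(real^'n \<Rightarrow> real^'m \<Rightarrow> real^'n) \<Rightarrow> (real \<Rightarrow> real^'n \<Rightarrow> real^'m \<Rightarrow> real) \<Rightarrow>
   'm::finite \<Rightarrow> real \<Rightarrow> real^'n \<Rightarrow> real^'m \<Rightarrow> real^'n \<Rightarrow> real" where
  "switching_fun f run a t x u l = partial_deriv a (\<lambda>v. hamiltonian f run t x v l) u"

text \<open>The bracket in the last clause is the factor of \<open>u\<^sup>1\<close> in the time derivative of \<open>\<xi>\<^sub>2\<close> along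
  an extremal.\<close>

definition singular_arc ::
  "(real^'n \<Rightarrow> real^'n) \<Rightarrow> (real^'n \<Rightarrow> real^'n) \<Rightarrow> (real^'n \<Rightarrow> real^2) \<Rightarrow> (real \<Rightarrow> real^2) \<Rightarrow>
   real \<Rightarrow> real^2^2 \<Rightarrow> real^2^2 \<Rightarrow>
   (real \<Rightarrow> real^'n) \<Rightarrow> (real \<Rightarrow> real^2) \<Rightarrow> (real \<Rightarrow> real^'n) \<Rightarrow> real set \<Rightarrow> bool" where
  "singular_arc g1 g2 \<phi> yd T Q M x u l Is \<longleftrightarrow>
     is_interval Is \<and> (\<exists>s\<in>Is. \<exists>t\<in>Is. s < t) \<and> Is \<subseteq> {0..T} \<and>
     (\<forall>t\<in>Is. let f = driftless g1 g2; run = track_running_cost g1 \<phi> yd T Q M in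
        switching_fun f run 1 t (x t) (u t) (l t) = 0 \<and>
        switching_fun f run 2 t (x t) (u t) (l t) = 0 \<and>
        - (track_err_rate g1 \<phi> yd T t (x t) (u t) \<bullet> (M *v lie_deriv (lie_bracket g1 g2) \<phi> (x t)))
          + l t \<bullet> lie_bracket g1 g2 (x t) = 0)"


section \<open>Explicit form of the necessary conditions\<close>

lemma lie_deriv_frechet:
  assumes "h differentiable (at x)"
  shows "lie_deriv g h x = frechet_derivative h (at x) (g x)"
proof -
  interpret bounded_linear "frechet_derivative h (at x)"
    using assms by (metis frechet_derivative_works has_derivative_bounded_linear)
  have "g x = (\<Sum>k\<in>UNIV. g x $ k *\<^sub>R axis k 1)"
    using basis_expansion[of "g x"] by (simp add: scalar_mult_eq_scaleR)
  then have "frechet_derivative h (at x) (g x) = (\<Sum>k\<in>UNIV. g x $ k *\<^sub>R frechet_derivative h (at x) (axis k 1))"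
    by (metis (no_types, lifting) scaleR sum sum.cong)
  then show ?thesis by (simp add: lie_deriv_def partial_deriv_def)
qed

lemma partial_derivI:
  assumes "(h has_derivative h') (at x)"
  shows "partial_deriv k h x = h' (axis k 1)"
  using frechet_derivative_at[OF assms] by (simp add: partial_deriv_def)

lemma symmetric_dot: "transpose A = A \<Longrightarrow> v \<bullet> (A *v w) = (A *v v) \<bullet> (w::real^'n)"
  by (metis dot_lmul_matrix transpose_matrix_vector)

lemma has_derivative_matrix_vector: "(f has_derivative f') F \<Longrightarrow> ((\<lambda>x. A *v f x) has_derivative (\<lambda>h. A *v f' h)) F" for A :: "real^'n^'m"
  by (rule bounded_linear.has_derivative[OF matrix_vector_mul_bounded_linear])

lemma switching_fun_explicit:
  assumes "sym_pos_def M"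
  shows "switching_fun (driftless g1 g2) (track_running_cost g1 \<phi> yd T Q M) 1 t x u l
    = - (track_err_rate g1 \<phi> yd T t x u \<bullet> (M *v lie_deriv g1 \<phi> x)) + l \<bullet> g1 x"
    and "switching_fun (driftless g1 g2) (track_running_cost g1 \<phi> yd T Q M) 2 t x u l = l \<bullet> g2 x"
proof -
  let ?e = "track_err_rate g1 \<phi> yd T t x" and ?a = "lie_deriv g1 \<phi> x"
  have M: "transpose M = M" using assms by (simp add: sym_pos_def_def)
  have e: "(?e has_derivative (\<lambda>h. - (h$1 *\<^sub>R ?a))) (at u)"
    unfolding track_err_rate_def by (auto intro!: derivative_eq_intros has_derivative_matrix_vector bounded_linear_imp_has_derivative bounded_linear_vec_nth)
  have "((\<lambda>v. hamiltonian (driftless g1 g2) (track_running_cost g1 \<phi> yd T Q M) t x v l) has_derivative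
     (\<lambda>h. 1/2 * (?e u \<bullet> (M *v (- (h$1 *\<^sub>R ?a))) + (- (h$1 *\<^sub>R ?a)) \<bullet> (M *v ?e u)) + l \<bullet> (h$1 *\<^sub>R g1 x + h$2 *\<^sub>R g2 x))) (at u)"
    unfolding hamiltonian_def track_running_cost_def driftless_def
    by (auto intro!: derivative_eq_intros has_derivative_matrix_vector e bounded_linear_imp_has_derivative bounded_linear_vec_nth)
  note * = partial_derivI[OF this]
  have 1: "?a \<bullet> (M *v ?e u) = ?e u \<bullet> (M *v ?a)" using M by (metis symmetric_dot inner_commute)
  show "switching_fun (driftless g1 g2) (track_running_cost g1 \<phi> yd T Q M) 1 t x u l
    = - (?e u \<bullet> (M *v ?a)) + l \<bullet> g1 x"
   "switching_fun (driftless g1 g2) (track_running_cost g1 \<phi> yd T Q M) 2 t x u l = l \<bullet> g2 x"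
    unfolding switching_fun_def * using 1 linear_neg[OF matrix_vector_mul_linear, of M ?a]
    by (auto simp: axis_def)
qed

lemma costate_rhs_explicit:
  assumes "sym_pos_def M" "sym_pos_def Q"
    "\<phi> differentiable (at x)" "lie_deriv g1 \<phi> differentiable (at x)"
    "g1 differentiable (at x)" "g2 differentiable (at x)"
  shows "- partial_deriv k (\<lambda>z. hamiltonian (driftless g1 g2) (track_running_cost g1 \<phi> yd T Q M) t z u l) x
    = track_err \<phi> yd t x \<bullet> (Q *v partial_deriv k \<phi> x)
      + track_err_rate g1 \<phi> yd T t x u \<bullet> (M *v partial_deriv k (lie_deriv g1 \<phi>) x) * u $ 1
      - l \<bullet> (u $ 1 *\<^sub>R partial_deriv k g1 x + u $ 2 *\<^sub>R partial_deriv k g2 x)"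
proof -
  have M: "transpose M = M" "transpose Q = Q" using assms by (simp_all add: sym_pos_def_def)
  let ?D = "\<lambda>h. frechet_derivative h (at x)"
  have d: "(\<phi> has_derivative ?D \<phi>) (at x)" "(lie_deriv g1 \<phi> has_derivative ?D (lie_deriv g1 \<phi>)) (at x)"
    "(g1 has_derivative ?D g1) (at x)" "(g2 has_derivative ?D g2) (at x)"
    using assms frechet_derivative_works by blast+
  let ?e = "\<lambda>x. track_err \<phi> yd t x" and ?r = "\<lambda>x. track_err_rate g1 \<phi> yd T t x u"
  have e: "(?e has_derivative (\<lambda>h. - ?D \<phi> h)) (at x)" "(?r has_derivative (\<lambda>h. - (u$1 *\<^sub>R ?D (lie_deriv g1 \<phi>) h))) (at x)"
    unfolding track_err_rate_def track_err_def by (auto intro!: derivative_eq_intros has_derivative_matrix_vector d)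
  have "((\<lambda>z. hamiltonian (driftless g1 g2) (track_running_cost g1 \<phi> yd T Q M) t z u l) has_derivative
     (\<lambda>h. 1/2 * ((?e x \<bullet> (Q *v (- ?D \<phi> h)) + (- ?D \<phi> h) \<bullet> (Q *v ?e x)) + (?r x \<bullet> (M *v (- (u$1 *\<^sub>R ?D (lie_deriv g1 \<phi>) h))) + (- (u$1 *\<^sub>R ?D (lie_deriv g1 \<phi>) h)) \<bullet> (M *v ?r x)))
      + l \<bullet> (u$1 *\<^sub>R ?D g1 h + u$2 *\<^sub>R ?D g2 h))) (at x)"
    unfolding hamiltonian_def track_running_cost_def driftless_def
    by (auto intro!: derivative_eq_intros has_derivative_matrix_vector e d)
  note * = partial_derivI[OF this]
  have 1: "a \<bullet> (M *v b) = b \<bullet> (M *v a)" "a \<bullet> (Q *v b) = b \<bullet> (Q *v a)" for a b using M by (metis symmetric_dot inner_commute)+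
  have n: "M *v (- a) = - (M *v a)" "Q *v (- a) = - (Q *v a)" for a
    by (simp_all add: linear_neg[OF matrix_vector_mul_linear])
  show ?thesis
    unfolding *
    by (simp add: partial_deriv_def n 1(1)[of "frechet_derivative (lie_deriv g1 \<phi>) (at x) (axis k 1)"] 1(2)[of "frechet_derivative \<phi> (at x) (axis k 1)"] algebra_simps matrix_vector_mult_scaleR)
qed

lemma terminal_costate_explicit:
  assumes "sym_pos_def Q" "\<phi> differentiable (at x)"
  shows "partial_deriv k (track_terminal_cost \<phi> yd T Q) x = - (track_err \<phi> yd T x \<bullet> (Q *v partial_deriv k \<phi> x))"
proof -
  have M: "transpose Q = Q" using assms by (simp_all add: sym_pos_def_def)
  let ?D = "\<lambda>h. frechet_derivative h (at x)" and ?e = "\<lambda>x. track_err \<phi> yd T x"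
  have d: "(\<phi> has_derivative ?D \<phi>) (at x)" using assms frechet_derivative_works by blast
  have e: "(?e has_derivative (\<lambda>h. - ?D \<phi> h)) (at x)"
    unfolding track_err_def by (auto intro!: derivative_eq_intros has_derivative_matrix_vector d)
  have "(track_terminal_cost \<phi> yd T Q has_derivative
     (\<lambda>h. 1/2 * (?e x \<bullet> (Q *v (- ?D \<phi> h)) + (- ?D \<phi> h) \<bullet> (Q *v ?e x)))) (at x)"
    unfolding track_terminal_cost_def[abs_def] by (auto intro!: derivative_eq_intros has_derivative_matrix_vector e)
  note * = partial_derivI[OF this]
  have 1: "a \<bullet> (Q *v b) = b \<bullet> (Q *v a)" for a b using M by (metis symmetric_dot inner_commute)
  show ?thesis unfolding *
    by (simp add: partial_deriv_def linear_neg[OF matrix_vector_mul_linear] 1[of "frechet_derivative \<phi> (at x) (axis k 1)"])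
qed

end

(*
  Idea.  Write a for the Lie derivative of \<phi> along g1.  On the jet domain of the flatness map,
  y' = u\<^sup>1 a(x).  Differentiating this identity in the coordinates of y' along the one-dimensional
  kernel of d\<phi> shows that a and its derivative along that kernel span the plane; hence x depends
  only on (y, y'), and g2 cannot vanish because y'' is free.  So g1, g2, [g1, g2] span the tangent
  space, and the three scalar conditions of a singular arc determine the costate:
  l = d\<phi>\<^sup>T M e'.

  For the second formula put \<zeta> = M e' + Qbar e.  By Q = Qbar M\<^sup>-\<^sup>1 Qbar the costate equation says that
  formally \<zeta>' = Qbar M\<^sup>-\<^sup>1 \<zeta>, with \<zeta>(T) = 0 by transversality.  As u is only piecewise
  continuous, the argument is run on m = l + d\<phi>\<^sup>T Qbar e, which is continuous and equals d\<phi>\<^sup>T \<zeta> on the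
  arc: there |m'| is bounded by a multiple of |m|, and Gronwall's inequality backwards from T gives m = 0.
*)

theory Submission
  imports Defs
begin

section \<open>Partial derivatives of smooth maps\<close>

lemma differentiable_lie_deriv:
  assumes "g differentiable (at z)" "\<And>k. partial_deriv k f differentiable (at z)"
  shows "lie_deriv g f differentiable (at z)"
proof -
  have "(\<lambda>z. g z $ k) differentiable (at z)" for k
    using assms(1) bounded_linear.has_derivative[OF bounded_linear_vec_nth]
    unfolding differentiable_def by blast
  then show ?thesis
    unfolding lie_deriv_def[abs_def] using assms(2)
    by (intro differentiable_sum differentiable_scaleR) auto
qed

section \<open>Symmetry of second partial derivatives\<close>

lemma has_real_derivative_line:
  fixes f :: "real^'n \<Rightarrow> 'b::real_inner"
  assumes "f differentiable (at (q + s *\<^sub>R axis j 1))"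
  shows "((\<lambda>s. w \<bullet> f (q + s *\<^sub>R axis j 1)) has_real_derivative
      w \<bullet> partial_deriv j f (q + s *\<^sub>R axis j 1)) (at s)"
proof -
  let ?D = "frechet_derivative f (at (q + s *\<^sub>R axis j 1))"
  have f: "(f has_derivative ?D) (at (q + s *\<^sub>R axis j 1))"
    using assms frechet_derivative_works by blast
  have "((\<lambda>s. q + s *\<^sub>R axis j 1) has_derivative (\<lambda>h. h *\<^sub>R axis j 1)) (at s)"
    by (auto intro!: derivative_eq_intros)
  from has_derivative_compose[OF this f]
  have "((\<lambda>s. f (q + s *\<^sub>R axis j 1)) has_derivative (\<lambda>h. ?D (h *\<^sub>R axis j 1))) (at s)" .
  then have "((\<lambda>s. w \<bullet> f (q + s *\<^sub>R axis j 1)) has_derivative (\<lambda>h. w \<bullet> ?D (h *\<^sub>R axis j 1))) (at s)"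
    by (rule has_derivative_inner_right)
  moreover have "(\<lambda>h. w \<bullet> ?D (h *\<^sub>R axis j 1))
      = (*) (w \<bullet> partial_deriv j f (q + s *\<^sub>R axis j 1))"
    by (simp add: partial_deriv_def linear_scale[OF has_derivative_linear[OF f]] fun_eq_iff)
  ultimately show ?thesis
    by (simp add: has_field_derivative_def)
qed

text \<open>Two applications of the mean value theorem, first along axis \<open>j\<close> and then
  along axis \<open>k\<close>. Pairing with a fixed \<open>w\<close> makes the functions
  real-valued, as that theorem requires.\<close>

lemma second_difference_eq_partial_deriv:
  fixes f :: "real^'n \<Rightarrow> 'b::real_inner"
  assumes f: "\<forall>z\<in>ball p e. f differentiable (at z)"
    and fj: "\<forall>z\<in>ball p e. partial_deriv j f differentiable (at z)"
    and h: "0 < h" "2 * h < e"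
  shows "\<exists>q\<in>ball p e. w \<bullet> (f (p + h *\<^sub>R axis j 1 + h *\<^sub>R axis k 1) - f (p + h *\<^sub>R axis j 1)
      - f (p + h *\<^sub>R axis k 1) + f p) = h * h * (w \<bullet> partial_deriv k (partial_deriv j f) q)"
proof -
  let ?j = "axis j 1 :: real^'n" and ?k = "axis k 1 :: real^'n"
  have B: "p + s *\<^sub>R ?j + t *\<^sub>R ?k \<in> ball p e" "p + t *\<^sub>R ?k + s *\<^sub>R ?j \<in> ball p e"
    if "0 \<le> s" "s \<le> h" "0 \<le> t" "t \<le> h" for s t
  proof -
    have "norm (s *\<^sub>R ?j + t *\<^sub>R ?k) \<le> \<bar>s\<bar> + \<bar>t\<bar>"
      by (rule norm_triangle_le) simp
    moreover have "dist p (p + s *\<^sub>R ?j + t *\<^sub>R ?k) = norm (s *\<^sub>R ?j + t *\<^sub>R ?k)"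
      by (metis add.assoc dist_add_cancel add.right_neutral dist_0_norm)
    ultimately show "p + s *\<^sub>R ?j + t *\<^sub>R ?k \<in> ball p e"
      using that h by simp
    then show "p + t *\<^sub>R ?k + s *\<^sub>R ?j \<in> ball p e"
      by (simp add: add_ac)
  qed
  \<comment> \<open>\<open>G s\<close> is the increment over a step \<open>h\<close> along axis
    \<open>k\<close>, taken after a displacement \<open>s\<close> along axis \<open>j\<close>; hence
    \<open>G h - G 0\<close> is the second difference.\<close>
  define G where "G s = w \<bullet> f (p + h *\<^sub>R ?k + s *\<^sub>R ?j) - w \<bullet> f (p + s *\<^sub>R ?j)" for s
  have "\<exists>s>0. s < h \<and> G h - G 0 = (h - 0) * (w \<bullet> partial_deriv j f (p + h *\<^sub>R ?k + s *\<^sub>R ?j)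
      - w \<bullet> partial_deriv j f (p + s *\<^sub>R ?j))"
    unfolding G_def using h B[of _ h] B[of _ 0] f
    by (intro MVT2 DERIV_diff has_real_derivative_line) auto
  then obtain s where s: "0 < s" "s < h" "G h - G 0 = h * (w \<bullet> partial_deriv j f (p + h *\<^sub>R ?k + s *\<^sub>R ?j)
      - w \<bullet> partial_deriv j f (p + s *\<^sub>R ?j))"
    by auto
  have "\<exists>t>0. t < h \<and> w \<bullet> partial_deriv j f (p + s *\<^sub>R ?j + h *\<^sub>R ?k)
      - w \<bullet> partial_deriv j f (p + s *\<^sub>R ?j + 0 *\<^sub>R ?k)
      = (h - 0) * (w \<bullet> partial_deriv k (partial_deriv j f) (p + s *\<^sub>R ?j + t *\<^sub>R ?k))"
    using h s B(1)[of s] fj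
    by (intro MVT2 has_real_derivative_line) auto
  then obtain t where t: "0 < t" "t < h" "w \<bullet> partial_deriv j f (p + s *\<^sub>R ?j + h *\<^sub>R ?k)
      - w \<bullet> partial_deriv j f (p + s *\<^sub>R ?j)
      = h * (w \<bullet> partial_deriv k (partial_deriv j f) (p + s *\<^sub>R ?j + t *\<^sub>R ?k))"
    by auto
  have "G h - G 0 = h * h * (w \<bullet> partial_deriv k (partial_deriv j f) (p + s *\<^sub>R ?j + t *\<^sub>R ?k))"
    using s(3) t(3) by (simp add: add_ac)
  moreover have "G h - G 0 = w \<bullet> (f (p + h *\<^sub>R ?j + h *\<^sub>R ?k) - f (p + h *\<^sub>R ?j)
      - f (p + h *\<^sub>R ?k) + f p)"
    by (simp add: G_def inner_diff_right inner_add_right add_ac)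
  ultimately show ?thesis
    using B(1)[of s t] s t by (intro bexI[of _ "p + s *\<^sub>R ?j + t *\<^sub>R ?k"]) auto
qed

text \<open>Schwarz's theorem. The second difference does not change when \<open>j\<close> and
  \<open>k\<close> are exchanged, so the two mixed derivatives, paired with \<open>w\<close>, agree
  at two points as close to \<open>p\<close> as desired; continuity then excludes a gap at
  \<open>p\<close>.\<close>

lemma partial_deriv_commute:
  fixes f :: "real^'n \<Rightarrow> 'b::real_inner"
  assumes X: "open X" "p \<in> X"
    and f: "\<forall>z\<in>X. f differentiable (at z)"
    and fk: "\<And>k. \<forall>z\<in>X. partial_deriv k f differentiable (at z)"
    and cont: "\<And>j k. continuous_on X (partial_deriv j (partial_deriv k f))"
  shows "partial_deriv j (partial_deriv k f) p = partial_deriv k (partial_deriv j f) p"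
proof (rule ccontr)
  let ?A = "partial_deriv j (partial_deriv k f)" and ?B = "partial_deriv k (partial_deriv j f)"
  assume "?A p \<noteq> ?B p"
  \<comment> \<open>Pairing with the supposed difference itself makes the gap
    \<open>\<epsilon>\<close> the squared norm of \<open>w\<close>, hence positive.\<close>
  define w where "w = ?A p - ?B p"
  define \<epsilon> where "\<epsilon> = w \<bullet> ?A p - w \<bullet> ?B p"
  have "\<epsilon> > 0"
    using \<open>?A p \<noteq> ?B p\<close> by (simp add: \<epsilon>_def w_def flip: inner_diff_right)
  have near: "\<exists>d>0. \<forall>q. dist q p < d \<longrightarrow> dist (w \<bullet> partial_deriv j (partial_deriv k f) q)
      (w \<bullet> partial_deriv j (partial_deriv k f) p) < \<epsilon> / 2" for j k
  proof -
    have "continuous (at p) (partial_deriv j (partial_deriv k f))"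
      using cont X continuous_on_eq_continuous_at by blast
    then have "continuous (at p) (\<lambda>q. w \<bullet> partial_deriv j (partial_deriv k f) q)"
      by (rule continuous_inner[OF continuous_const])
    then show ?thesis
      using \<open>\<epsilon> > 0\<close> half_gt_zero[OF \<open>\<epsilon> > 0\<close>] unfolding continuous_at_eps_delta by blast
  qed
  obtain d1 where d1: "d1 > 0" "\<And>q. dist q p < d1 \<Longrightarrow> dist (w \<bullet> ?A q) (w \<bullet> ?A p) < \<epsilon> / 2"
    using near[of j k] by blast
  obtain d2 where d2: "d2 > 0" "\<And>q. dist q p < d2 \<Longrightarrow> dist (w \<bullet> ?B q) (w \<bullet> ?B p) < \<epsilon> / 2"
    using near[of k j] by blast
  obtain d0 where d0: "d0 > 0" "ball p d0 \<subseteq> X"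
    using X open_contains_ball by blast
  define e where "e = min d0 (min d1 d2)"
  define h where "h = e / 4"
  have e: "e > 0" "e \<le> d0" "e \<le> d1" "e \<le> d2" and h: "h > 0" "2 * h < e"
    using d1(1) d2(1) d0(1) by (auto simp: e_def h_def)
  have e_sub: "ball p e \<subseteq> X"
    using d0(2) e(2) by auto
  let ?\<Delta> = "\<lambda>j k. w \<bullet> (f (p + h *\<^sub>R axis j 1 + h *\<^sub>R axis k 1) - f (p + h *\<^sub>R axis j 1)
      - f (p + h *\<^sub>R axis k 1) + f p)"
  have *: "\<exists>q\<in>ball p e. ?\<Delta> j k = h * h * (w \<bullet> partial_deriv k (partial_deriv j f) q)" for j k
    using f fk e_sub h by (intro second_difference_eq_partial_deriv) auto
  obtain q where q: "q \<in> ball p e" "?\<Delta> k j = h * h * (w \<bullet> ?A q)"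
    using *[of k j] by auto
  obtain q' where q': "q' \<in> ball p e" "?\<Delta> j k = h * h * (w \<bullet> ?B q')"
    using *[of j k] by auto
  have "?\<Delta> j k = ?\<Delta> k j"
    by (simp add: algebra_simps)
  then have "w \<bullet> ?A q = w \<bullet> ?B q'"
    using q q' h by simp
  moreover have "dist (w \<bullet> ?A q) (w \<bullet> ?A p) < \<epsilon> / 2" "dist (w \<bullet> ?B q') (w \<bullet> ?B p) < \<epsilon> / 2"
    using q(1) q'(1) e d1(2)[of q] d2(2)[of q'] by (simp_all add: dist_commute)
  moreover have False if "a = b" "dist a a' < \<epsilon> / 2" "dist b b' < \<epsilon> / 2" "a' - b' = \<epsilon>"
    for a b a' b' :: real
    using that unfolding dist_real_def by linarith
  ultimately show False
    using \<epsilon>_def by blast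
qed

lemma smooth_onD:
  assumes "smooth_on f X" "open X"
  shows smooth_on_partial_deriv: "smooth_on (partial_deriv k f) X"
    and smooth_on_differentiable: "z \<in> X \<Longrightarrow> f differentiable (at z)"
    and smooth_on_continuous: "continuous_on X f"
proof -
  have *: "Ck_on (Suc n) f X" for n
    using assms by (auto simp: smooth_on_def)
  show "smooth_on (partial_deriv k f) X"
    using * by (auto simp: smooth_on_def)
  show "f differentiable (at z)" if "z \<in> X"
    using *[of 0] assms(2) that by (auto simp: differentiable_on_eq_differentiable_at)
  show "continuous_on X f"
    using *[of 0] by (auto intro: differentiable_imp_continuous_on)
qed

lemma smooth_on_partial_deriv_commute:
  fixes f :: "real^'n \<Rightarrow> 'b::real_inner"
  assumes "smooth_on f X" "open X" "p \<in> X"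
  shows "partial_deriv j (partial_deriv k f) p = partial_deriv k (partial_deriv j f) p"
  using assms
  by (intro partial_deriv_commute[of X])
    (auto intro: smooth_on_differentiable smooth_on_continuous smooth_on_partial_deriv)

section \<open>Lie derivatives and the Lie bracket\<close>

lemma partial_deriv_lie_deriv:
  fixes f :: "real^'n \<Rightarrow> 'b::real_inner"
  assumes "smooth_on f X" "open X" "p \<in> X" "g differentiable (at p)"
  shows "partial_deriv k (lie_deriv g f) p
    = lie_deriv g (partial_deriv k f) p + (\<Sum>i\<in>UNIV. partial_deriv k g p $ i *\<^sub>R partial_deriv i f p)"
proof -
  let ?D = "\<lambda>f. frechet_derivative f (at p)"
  have g: "(g has_derivative ?D g) (at p)"
    using assms frechet_derivative_works by blast
  have f: "(partial_deriv i f has_derivative ?D (partial_deriv i f)) (at p)" for i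
    using smooth_on_differentiable[OF smooth_on_partial_deriv] assms frechet_derivative_works by blast
  have "(lie_deriv g f has_derivative (\<lambda>h. \<Sum>i\<in>UNIV. g p $ i *\<^sub>R ?D (partial_deriv i f) h
      + (?D g h) $ i *\<^sub>R partial_deriv i f p)) (at p)"
    unfolding lie_deriv_def[abs_def]
    by (intro has_derivative_sum has_derivative_scaleR bounded_linear.has_derivative[OF bounded_linear_vec_nth] f g)
  from partial_derivI[OF this, of k] have "partial_deriv k (lie_deriv g f) p
    = (\<Sum>i\<in>UNIV. g p $ i *\<^sub>R partial_deriv k (partial_deriv i f) p + partial_deriv k g p $ i *\<^sub>R partial_deriv i f p)"
    by (simp add: partial_deriv_def)
  then show ?thesis
    using smooth_on_partial_deriv_commute[OF assms(1-3), of k] by (simp add: lie_deriv_def sum.distrib)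
qed

text \<open>Each iterated Lie derivative is a second-order part plus a first-order part. The
  second-order parts coincide by symmetry and cancel in the commutator; the first-order parts
  combine to the derivative along the bracket.\<close>

lemma lie_deriv_lie_bracket:
  fixes f :: "real^'n \<Rightarrow> 'b::real_inner"
  assumes f: "smooth_on f X" "open X" "p \<in> X"
    and gh: "g differentiable (at p)" "h differentiable (at p)"
  shows "lie_deriv (lie_bracket g h) f p = lie_deriv g (lie_deriv h f) p - lie_deriv h (lie_deriv g f) p"
proof -
  have *: "lie_deriv g (lie_deriv h f) p = (\<Sum>k\<in>UNIV. \<Sum>i\<in>UNIV. (g p $ k * h p $ i) *\<^sub>R partial_deriv i (partial_deriv k f) p)
    + (\<Sum>i\<in>UNIV. lie_deriv g h p $ i *\<^sub>R partial_deriv i f p)"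
    if "h differentiable (at p)" for g h
  proof -
    have "(\<Sum>k\<in>UNIV. g p $ k *\<^sub>R (\<Sum>i\<in>UNIV. partial_deriv k h p $ i *\<^sub>R partial_deriv i f p))
      = (\<Sum>i\<in>UNIV. \<Sum>k\<in>UNIV. (g p $ k * partial_deriv k h p $ i) *\<^sub>R partial_deriv i f p)"
      by (subst sum.swap) (simp add: scaleR_sum_right)
    also have "\<dots> = (\<Sum>i\<in>UNIV. lie_deriv g h p $ i *\<^sub>R partial_deriv i f p)"
      by (simp add: lie_deriv_def scaleR_sum_left sum_component)
    finally show ?thesis
      unfolding lie_deriv_def[of g "lie_deriv h f"] partial_deriv_lie_deriv[OF f that]
      by (simp add: scaleR_add_right sum.distrib scaleR_sum_right lie_deriv_def[of h])
  qed
  have "(\<Sum>k\<in>UNIV. \<Sum>i\<in>UNIV. (g p $ k * h p $ i) *\<^sub>R partial_deriv i (partial_deriv k f) p)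
    = (\<Sum>k\<in>UNIV. \<Sum>i\<in>UNIV. (h p $ k * g p $ i) *\<^sub>R partial_deriv i (partial_deriv k f) p)"
    by (subst sum.swap) (simp add: smooth_on_partial_deriv_commute[OF f] mult.commute)
  then show ?thesis
    unfolding *[OF gh(1)] *[OF gh(2)]
    by (simp add: lie_deriv_def[of "lie_bracket g h"] lie_bracket_def scaleR_diff_left sum_subtractf)
qed

section \<open>Linear algebra in the plane and in space\<close>

text \<open>The determinant of the matrix with columns \<open>v\<close> and \<open>w\<close>: it is
  nonzero exactly when they form a basis of the plane.\<close>

definition cross2 :: "real^2 \<Rightarrow> real^2 \<Rightarrow> real" where
  "cross2 v w = v $ 1 * w $ 2 - v $ 2 * w $ 1"

text \<open>Makes the product rule available for determinants of curves.\<close>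

lemma bounded_bilinear_cross2: "bounded_bilinear cross2"
proof
  show "\<exists>K. \<forall>v w. norm (cross2 v w) \<le> norm v * norm w * K"
  proof (intro exI allI)
    fix v w :: "real^2"
    have "\<bar>v $ i\<bar> * \<bar>w $ j\<bar> \<le> norm v * norm w" for i j :: 2
      by (intro mult_mono component_le_norm_cart) auto
    from this[of 1 2] this[of 2 1] show "norm (cross2 v w) \<le> norm v * norm w * 2"
      by (simp add: cross2_def abs_mult[symmetric])
  qed
qed (simp_all add: cross2_def algebra_simps)

lemma cross2_self [simp]: "cross2 v v = 0"
  by (simp add: cross2_def)

lemma cross2_axis: "cross2 (axis 1 1) v = v $ 2" "cross2 (axis 2 1) v = - v $ 1"
  by (simp_all add: cross2_def axis_def)

lemma cross2_axis_axis: "cross2 (axis 1 1) (axis 2 1) = 1"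
  unfolding cross2_axis by (simp add: axis_def)

text \<open>The \<open>v i\<close> show that \<open>D\<close> is onto, so its kernel has dimension
  one: \<open>n\<close>, \<open>v 1\<close>, \<open>v 2\<close> form a basis of space, and the image
  under \<open>D\<close> reads off the coefficients of the last two.\<close>

lemma kernel_line:
  fixes D :: "real^3 \<Rightarrow> real^2"
  assumes D: "linear D" "\<And>i. D (v i) = axis i 1"
    and n: "D n = 0" "n \<noteq> 0" and w: "D w = 0"
  shows "\<exists>c. w = c *\<^sub>R n"
proof -
  interpret linear D by fact
  have coeffs: "b 1 = 0 \<and> b 2 = 0" if "D (b 1 *\<^sub>R v 1 + b 2 *\<^sub>R v 2) = 0" for b :: "2 \<Rightarrow> real"
  proof -
    from that have "b 1 *\<^sub>R axis 1 1 + b 2 *\<^sub>R axis 2 1 = (0 :: real^2)"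
      by (simp add: add scaleR D(2))
    then show ?thesis
      by (simp add: vec_eq_iff forall_2 axis_def)
  qed
  have n_notin: "n \<notin> span {v 1, v 2}"
  proof
    assume "n \<in> span {v 1, v 2}"
    then obtain a b where ab: "n = a *\<^sub>R v 1 + b *\<^sub>R v 2"
      by (auto simp: span_insert span_singleton algebra_simps)
    then show False
      using coeffs[of "\<lambda>i. if i = 1 then a else b"] n by simp
  qed
  have v1: "v 1 \<notin> span {v 2}"
  proof
    assume "v 1 \<in> span {v 2}"
    then obtain b where "v 1 = b *\<^sub>R v 2"
      by (auto simp: span_singleton)
    then show False
      using coeffs[of "\<lambda>i. if i = 1 then 1 else - b"] by simp
  qed
  have v2: "v 2 \<noteq> 0"
    using coeffs[of "\<lambda>i. if i = 1 then 0 else 1"] by auto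
  have ind: "independent {n, v 1, v 2}"
    using n_notin v1 v2 by (simp add: independent_insert)
  have "n \<notin> {v 1, v 2}" "v 1 \<noteq> v 2"
    using n_notin v1 span_base[of n "{v 1, v 2}"] span_base[of "v 2" "{v 2}"] by fastforce+
  then have "card {n, v 1, v 2} = 3"
    by auto
  with ind have "w \<in> span {n, v 1, v 2}"
    using card_ge_dim_independent[of "{n, v 1, v 2}" UNIV] by auto
  then obtain a b c where abc: "w = a *\<^sub>R n + (b *\<^sub>R v 1 + c *\<^sub>R v 2)"
    by (auto simp: span_insert span_singleton algebra_simps)
  then have "D (b *\<^sub>R v 1 + c *\<^sub>R v 2) = 0"
    using w n by (simp add: add scaleR)
  with abc show ?thesis
    using coeffs[of "\<lambda>i. if i = 1 then b else c"] by auto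
qed

text \<open>All \<open>w i\<close> are multiples of one kernel vector \<open>n\<close>, so both axis
  vectors are combinations of \<open>a\<close> and \<open>A n\<close>. Their determinant 1 is then a
  multiple of \<open>c * cross2 a (A n)\<close>, and neither factor can vanish. It is applied with
  \<open>D\<close> and \<open>A\<close> the derivatives of \<phi> and of its Lie derivative along
  \<open>g1\<close>.\<close>

lemma transversal_on_kernel:
  fixes D A :: "real^3 \<Rightarrow> real^2"
  assumes D: "linear D" "\<And>i. D (v i) = axis i 1" and A: "linear A"
    and w: "\<And>i. D (w i) = 0" "\<And>i. axis i 1 = \<alpha> i *\<^sub>R a + c *\<^sub>R A (w i)"
  shows "c \<noteq> 0" "D n = 0 \<Longrightarrow> n \<noteq> 0 \<Longrightarrow> cross2 a (A n) \<noteq> 0"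
proof -
  interpret cross2: bounded_bilinear cross2 by (rule bounded_bilinear_cross2)
  have *: "c \<noteq> 0 \<and> cross2 a (A n) \<noteq> 0" if n: "D n = 0" "n \<noteq> 0" for n
  proof -
    obtain b where b: "\<And>i. w i = b i *\<^sub>R n"
      using kernel_line[OF D n w(1)] by metis
    have e: "axis i 1 = \<alpha> i *\<^sub>R a + (c * b i) *\<^sub>R A n" for i
      using w(2)[of i] b[of i] linear_scale[OF A] by simp
    have "1 = cross2 (axis 1 1) (axis 2 1)"
      by (simp add: cross2_axis_axis)
    also have "\<dots> = c * (\<alpha> 1 * b 2 - \<alpha> 2 * b 1) * cross2 a (A n)"
      unfolding e by (simp add: cross2_def algebra_simps)
    finally show ?thesis
      by auto
  qed
  \<comment> \<open>The claim on \<open>c\<close> needs some nonzero kernel vector. If all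
    \<open>w i\<close> vanished, both axis vectors would be multiples of \<open>a\<close>.\<close>
  have "\<exists>i. w i \<noteq> 0"
  proof (rule ccontr)
    assume "\<nexists>i. w i \<noteq> 0"
    then have e: "axis i 1 = \<alpha> i *\<^sub>R a" for i
      using w(2)[of i] linear_0[OF A] by simp
    have "1 = cross2 (axis 1 1) (axis 2 1)"
      by (simp add: cross2_axis_axis)
    also have "\<dots> = 0"
      unfolding e by (simp add: cross2_def)
    finally show False by simp
  qed
  then show "c \<noteq> 0"
    using * w(1) by blast
  show "cross2 a (A n) \<noteq> 0" if "D n = 0" "n \<noteq> 0"
    using * that by blast
qed

section \<open>Flat outputs\<close>

lemma has_vector_derivative_taylor:
  "((\<lambda>t. \<Sum>j\<in>{k..N}. (t ^ (j - k) / fact (j - k)) *\<^sub>R \<eta> j) has_vector_derivative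
    (\<Sum>j\<in>{Suc k..N}. (t ^ (j - Suc k) / fact (j - Suc k)) *\<^sub>R (\<eta> j :: 'a::real_normed_vector))) (at t)"
proof -
  have "((\<lambda>t. t ^ (j - k) / fact (j - k) :: real) has_real_derivative
      (if j = k then 0 else t ^ (j - Suc k) / fact (j - Suc k))) (at t)" if "j \<ge> k" for j
  proof (cases "j = k")
    case False
    define i where "i = j - Suc k"
    have j: "j - k = Suc i"
      using False that by (simp add: i_def)
    have "((\<lambda>t. t ^ Suc i / fact (Suc i) :: real) has_real_derivative real (Suc i) * t ^ i / fact (Suc i)) (at t)"
      using DERIV_cdivide[OF DERIV_pow[of "Suc i" t UNIV], of "fact (Suc i)"]
      by (simp del: fact_Suc power_Suc)
    also have "real (Suc i) * t ^ i / fact (Suc i) = t ^ i / fact i"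
      unfolding fact_Suc by (rule mult_divide_mult_cancel_left) simp
    finally show ?thesis
      unfolding j using False by (simp add: i_def)
  qed auto
  then have "((\<lambda>t. \<Sum>j\<in>{k..N}. (t ^ (j - k) / fact (j - k)) *\<^sub>R \<eta> j) has_vector_derivative
      (\<Sum>j\<in>{k..N}. (if j = k then 0 else t ^ (j - Suc k) / fact (j - Suc k)) *\<^sub>R \<eta> j)) (at t)"
    by (intro has_vector_derivative_sum bounded_linear.has_vector_derivative[OF bounded_linear_scaleR_left])
      (simp flip: has_real_derivative_iff_has_vector_derivative)
  also have "(\<Sum>j\<in>{k..N}. (if j = k then 0 else t ^ (j - Suc k) / fact (j - Suc k)) *\<^sub>R \<eta> j)
      = (\<Sum>j\<in>{Suc k..N}. (t ^ (j - Suc k) / fact (j - Suc k)) *\<^sub>R \<eta> j)"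
    by (rule sum.mono_neutral_cong_right) auto
  finally show ?thesis .
qed

text \<open>A Taylor polynomial realizes finitely many derivatives at 0, which is enough for maps
  depending on finitely many entries of a jet.\<close>

lemma curve_through_jet:
  fixes \<eta> :: "nat \<Rightarrow> 'a::real_normed_vector"
  obtains Y where "curve_derivs UNIV Y" "\<And>k. k \<le> N \<Longrightarrow> Y k 0 = \<eta> k"
proof
  let ?Y = "\<lambda>k t. \<Sum>j\<in>{k..N}. (t ^ (j - k) / fact (j - k)) *\<^sub>R \<eta> j"
  show "curve_derivs UNIV ?Y"
    by (auto simp: curve_derivs_def has_vector_derivative_taylor)
  show "?Y k 0 = \<eta> k" if "k \<le> N" for k
  proof -
    \<comment> \<open>Only the summand \<open>j = k\<close> survives at time 0, because
      \<open>0 ^ 0 = 1\<close>.\<close>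
    have "?Y k 0 = (\<Sum>j\<in>{k}. (0 ^ (j - k) / fact (j - k)) *\<^sub>R \<eta> j)"
      using that by (intro sum.mono_neutral_right) auto
    then show ?thesis by simp
  qed
qed

section \<open>Differentiation in jet coordinates and along curves\<close>

lemma jet_move_add: "jet_move k i (jet_move k i \<eta> s) t = jet_move k i \<eta> (s + t)"
  by (simp add: jet_move_def fun_eq_iff algebra_simps)

lemma jet_move_apply: "jet_move k i \<eta> s j = \<eta> j + (if j = k then s *\<^sub>R axis i 1 else 0)"
  by (simp add: jet_move_def)

lemma continuous_on_jet_move: "continuous_on UNIV (jet_move k i \<eta>)"
proof (rule continuous_on_coordinatewise_then_product)
  show "continuous_on UNIV (\<lambda>s. jet_move k i \<eta> s j)" for j
    by (cases "j = k") (simp_all add: jet_move_apply continuous_intros)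
qed

lemma continuous_on_jet:
  assumes "curve_derivs UNIV Y"
  shows "continuous_on UNIV (\<lambda>t k. Y k t)"
proof (rule continuous_on_coordinatewise_then_product)
  fix k
  have "(Y k has_vector_derivative Y (Suc k) t) (at t)" for t
    using assms by (auto simp: curve_derivs_def)
  then show "continuous_on UNIV (Y k)"
    by (meson continuous_at_imp_continuous_on has_vector_derivative_continuous)
qed

text \<open>The definition of smoothness differentiates only at parameter 0. Taking the moved jet as
  the new base jet, by \<open>jet_move_add\<close>, transfers this to every parameter
  \<open>s\<close>.\<close>

lemma jet_smooth_on_has_vector_derivative:
  assumes "jet_smooth_on F W" "jet_move k i \<eta> s \<in> W"
  shows "((\<lambda>s. F (jet_move k i \<eta> s)) has_vector_derivative jet_partial k i F (jet_move k i \<eta> s)) (at s)"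
proof -
  have "jet_Ck_on (Suc 0) F W"
    using assms(1) unfolding jet_smooth_on_def by blast
  then have "((\<lambda>t. F (jet_move k i (jet_move k i \<eta> s) t)) has_vector_derivative
      jet_partial k i F (jet_move k i \<eta> s)) (at 0)"
    using assms(2) unfolding jet_partial_def by (auto simp: vector_derivative_works)
  then have *: "((\<lambda>t. F (jet_move k i \<eta> (s + t))) has_vector_derivative jet_partial k i F (jet_move k i \<eta> s)) (at 0)"
    by (simp add: jet_move_add)
  have "((\<lambda>t. t - s) has_vector_derivative 1) (at s)"
    by (auto intro!: derivative_eq_intros)
  from vector_diff_chain_at[OF this, of "\<lambda>t. F (jet_move k i \<eta> (s + t))"] * show ?thesis
    by (simp add: o_def)
qed

text \<open>Used to differentiate identities between curves that hold on an open set of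
  parameters.\<close>

lemma has_vector_derivative_unique_open:
  assumes "(f has_vector_derivative f') (at t)" "(g has_vector_derivative g') (at t)"
    and "open J" "t \<in> J" "\<And>s. s \<in> J \<Longrightarrow> f s = g s"
  shows "f' = g'"
  using has_vector_derivative_transform_within_open[OF assms(1,3,4)] assms(2,5)
  by (metis vector_derivative_unique_at)

lemma has_vector_derivative_frechet_compose:
  assumes "(x has_vector_derivative x') (at t within S)" "f differentiable (at (x t))"
  shows "((\<lambda>t. f (x t)) has_vector_derivative frechet_derivative f (at (x t)) x') (at t within S)"
proof -
  have "(f has_derivative frechet_derivative f (at (x t))) (at (x t) within x ` S)"
    using assms(2) by (simp add: frechet_derivative_works has_derivative_at_withinI)
  from vector_derivative_diff_chain_within[OF assms(1) this] show ?thesis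
    by (simp add: o_def)
qed

lemma frechet_derivative_driftless:
  assumes "f differentiable (at z)"
  shows "frechet_derivative f (at z) (driftless g1 g2 z u)
    = u $ 1 *\<^sub>R lie_deriv g1 f z + u $ 2 *\<^sub>R lie_deriv g2 f z"
proof -
  interpret linear "frechet_derivative f (at z)"
    by (rule linear_frechet_derivative[OF assms])
  show ?thesis
    by (simp add: driftless_def add scaleR lie_deriv_frechet[OF assms])
qed

text \<open>A local flatness map together with the freeness of its curves: every curve with jets in
  \<open>W\<close> comes from a trajectory. Test curves can thus be inserted at will and the
  resulting identities compared.\<close>

locale flat_parametrization =
  fixes g1 g2 :: "real^3 \<Rightarrow> real^3" and \<phi> :: "real^3 \<Rightarrow> real^2" and X :: "(real^3) set"
    and r :: nat and W :: "(nat \<Rightarrow> real^2) set" and F :: "(nat \<Rightarrow> real^2) \<Rightarrow> (real^3) \<times> (real^2)"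
  assumes open_X: "open X"
    and smooth_g1: "smooth_on g1 X" and smooth_\<phi>: "smooth_on \<phi> X"
    and lie_g2_\<phi>: "z \<in> X \<Longrightarrow> lie_deriv g2 \<phi> z = 0"
    and open_W: "open W" and order_F: "jet_order_le r F W" and smooth_F: "jet_smooth_on F W"
    and trajectory: "open J \<Longrightarrow> curve_derivs J Y \<Longrightarrow> (\<forall>t\<in>J. (\<lambda>k. Y k t) \<in> W) \<Longrightarrow>
      (\<lambda>t. fst (F (\<lambda>k. Y k t))) ` J \<subseteq> X \<and>
      ode_solution_on (driftless g1 g2) J (\<lambda>t. fst (F (\<lambda>k. Y k t))) (\<lambda>t. snd (F (\<lambda>k. Y k t))) \<and>
      (\<forall>t\<in>J. \<phi> (fst (F (\<lambda>k. Y k t))) = Y 0 t)"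
begin

section \<open>Consequences of a local flatness map\<close>

abbreviation "D\<phi> z \<equiv> frechet_derivative \<phi> (at z)"
abbreviation "a \<equiv> lie_deriv g1 \<phi>"
abbreviation "Da z \<equiv> frechet_derivative a (at z)"

lemma differentiable_\<phi>: "z \<in> X \<Longrightarrow> \<phi> differentiable (at z)"
  using smooth_\<phi> open_X by (rule smooth_on_differentiable)

lemma differentiable_a: "z \<in> X \<Longrightarrow> a differentiable (at z)"
  using smooth_\<phi> smooth_g1 open_X
  by (intro differentiable_lie_deriv smooth_on_differentiable) (auto intro: smooth_on_partial_deriv)

lemma trajectory_through:
  assumes "\<eta> \<in> W"
  obtains J Y x u where "open J" "0 \<in> J" "x ` J \<subseteq> X"
    "\<And>t. t \<in> J \<Longrightarrow> (x has_vector_derivative driftless g1 g2 (x t) (u t)) (at t)"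
    "\<And>t. t \<in> J \<Longrightarrow> \<phi> (x t) = Y 0 t"
    "\<And>k t. t \<in> J \<Longrightarrow> (Y k has_vector_derivative Y (Suc k) t) (at t)"
    "x 0 = fst (F \<eta>)" "u 0 = snd (F \<eta>)" "\<And>k. k \<le> 2 \<Longrightarrow> Y k 0 = \<eta> k"
proof -
  \<comment> \<open>Agreement up to order \<open>r\<close> gives \<open>F\<close> the same value on
    the jet of \<open>Y\<close> at 0 as on \<open>\<eta>\<close>, although the polynomial has
    different higher derivatives in general; order 2 ensures that \<open>y'\<close> and
    \<open>y''\<close> are prescribed as well.\<close>
  obtain Y where Y: "curve_derivs UNIV Y" "\<And>k. k \<le> max r 2 \<Longrightarrow> Y k 0 = \<eta> k"
    using curve_through_jet[of "max r 2" \<eta>] by metis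
  have "\<forall>k\<le>r. Y k 0 = \<eta> k"
    using Y(2) by simp
  then have "(\<lambda>k. Y k 0) \<in> W \<longleftrightarrow> \<eta> \<in> W" and F0: "F (\<lambda>k. Y k 0) = F \<eta>"
    using order_F[unfolded jet_order_le_def, rule_format, of "\<lambda>k. Y k 0" \<eta>] by blast+
  then have W0: "(\<lambda>k. Y k 0) \<in> W"
    using assms by blast
  \<comment> \<open>Since \<open>W\<close> is open, the jets of \<open>Y\<close> stay in it for all
    times near 0.\<close>
  define J where "J = (\<lambda>t k. Y k t) -` W"
  have J: "open J" "0 \<in> J" "\<forall>t\<in>J. (\<lambda>k. Y k t) \<in> W"
    unfolding J_def using open_vimage[OF open_W continuous_on_jet[OF Y(1)]] W0 by blast+
  have Y': "(Y k has_vector_derivative Y (Suc k) t) (at t)" for k t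
    using Y(1) by (auto simp: curve_derivs_def)
  then have "curve_derivs J Y"
    by (auto simp: curve_derivs_def intro: has_vector_derivative_at_within)
  note traj = trajectory[OF J(1) this J(3)]
  show ?thesis
  proof (rule that[OF J(1,2)])
    show "(\<lambda>t. fst (F (\<lambda>k. Y k t))) ` J \<subseteq> X" "\<And>t. t \<in> J \<Longrightarrow> \<phi> (fst (F (\<lambda>k. Y k t))) = Y 0 t"
      using traj by blast+
    show "((\<lambda>t. fst (F (\<lambda>k. Y k t))) has_vector_derivative
        driftless g1 g2 (fst (F (\<lambda>k. Y k t))) (snd (F (\<lambda>k. Y k t)))) (at t)" if "t \<in> J" for t
      using traj that at_within_open[OF that J(1)] unfolding ode_solution_on_def by metis
  qed (use F0 Y' Y(2) in simp_all)
qed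

lemma rate_along_trajectory:
  assumes "open J" "t \<in> J" "x t \<in> X"
    and "(x has_vector_derivative driftless g1 g2 (x t) u) (at t)"
    and "\<And>t. t \<in> J \<Longrightarrow> \<phi> (x t) = y t" "(y has_vector_derivative y') (at t)"
  shows "y' = u $ 1 *\<^sub>R a (x t)"
proof -
  have "((\<lambda>t. \<phi> (x t)) has_vector_derivative D\<phi> (x t) (driftless g1 g2 (x t) u)) (at t)"
    using assms differentiable_\<phi> by (intro has_vector_derivative_frechet_compose) auto
  from has_vector_derivative_unique_open[OF this assms(6,1,2,5)] show ?thesis
    using assms(3) frechet_derivative_driftless[OF differentiable_\<phi>, of "x t" g1 g2 u] lie_g2_\<phi> by simp
qed

text \<open>Each identity is evaluated at time 0 on a trajectory through the jet. The last one
  differentiates \<open>cross2 y' (a x) = 0\<close>, which holds because \<open>y'\<close> is a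
  multiple of \<open>a x\<close>; the determinant eliminates \<open>u\<^sup>1\<close> first, so no
  derivative of the input appears.\<close>

lemma state_of_jet:
  assumes "\<eta> \<in> W"
  shows "fst (F \<eta>) \<in> X" "\<phi> (fst (F \<eta>)) = \<eta> 0" "\<eta> 1 = snd (F \<eta>) $ 1 *\<^sub>R a (fst (F \<eta>))"
    "cross2 (\<eta> 2) (a (fst (F \<eta>))) + cross2 (\<eta> 1) (Da (fst (F \<eta>)) (driftless g1 g2 (fst (F \<eta>)) (snd (F \<eta>)))) = 0"
proof -
  interpret cross2: bounded_bilinear cross2 by (rule bounded_bilinear_cross2)
  obtain J Y x u where J: "open J" "0 \<in> J" and X: "x ` J \<subseteq> X"
    and x: "\<And>t. t \<in> J \<Longrightarrow> (x has_vector_derivative driftless g1 g2 (x t) (u t)) (at t)"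
    and \<phi>: "\<And>t. t \<in> J \<Longrightarrow> \<phi> (x t) = Y 0 t"
    and Y: "\<And>k t. t \<in> J \<Longrightarrow> (Y k has_vector_derivative Y (Suc k) t) (at t)"
    and at_0: "x 0 = fst (F \<eta>)" "u 0 = snd (F \<eta>)" "\<And>k. k \<le> 2 \<Longrightarrow> Y k 0 = \<eta> k"
    using trajectory_through[OF assms] by metis
  have rate: "Y 1 t = u t $ 1 *\<^sub>R a (x t)" if "t \<in> J" for t
    using rate_along_trajectory[OF J(1) that _ x[OF that] \<phi> Y[OF that]] X that by auto
  show "fst (F \<eta>) \<in> X" "\<phi> (fst (F \<eta>)) = \<eta> 0" "\<eta> 1 = snd (F \<eta>) $ 1 *\<^sub>R a (fst (F \<eta>))"
    using J X \<phi>[of 0] rate[of 0] at_0 by auto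
  have "((\<lambda>t. a (x t)) has_vector_derivative Da (x 0) (driftless g1 g2 (x 0) (u 0))) (at 0)"
    using X J x differentiable_a by (intro has_vector_derivative_frechet_compose) auto
  from has_vector_derivative_unique_open[OF cross2.has_vector_derivative[OF Y[OF J(2), of 1] this]
      has_vector_derivative_const J, of 0]
  have "cross2 (Y 1 0) (Da (x 0) (driftless g1 g2 (x 0) (u 0))) + cross2 (Y 2 0) (a (x 0)) = 0"
    by (simp add: rate[unfolded One_nat_def] cross2.scaleR_left numeral_2_eq_2)
  then show "cross2 (\<eta> 2) (a (fst (F \<eta>))) + cross2 (\<eta> 1) (Da (fst (F \<eta>)) (driftless g1 g2 (fst (F \<eta>)) (snd (F \<eta>)))) = 0"
    using at_0 by simp
qed

lemma open_jet_move: "open {s. jet_move k i \<eta> s \<in> W}"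
  using continuous_on_jet_move[of k i \<eta>] open_W by (simp add: continuous_on_open_vimage vimage_def)

lemma jet_move_0: "jet_move k i \<eta> 0 = \<eta>"
  by (simp add: jet_move_def)

text \<open>The identities of \<open>state_of_jet\<close> hold on all of the open set
  \<open>W\<close>, so they may be differentiated in any single jet coordinate, the entries of a jet
  being independent variables.\<close>

lemma jet_partial_relations:
  assumes "\<eta> \<in> W"
  shows "D\<phi> (fst (F \<eta>)) (fst (jet_partial k i F \<eta>)) = (if k = 0 then axis i 1 else 0)"
    and "(if k = 1 then axis i 1 else 0) = snd (jet_partial k i F \<eta>) $ 1 *\<^sub>R a (fst (F \<eta>))
      + snd (F \<eta>) $ 1 *\<^sub>R Da (fst (F \<eta>)) (fst (jet_partial k i F \<eta>))"
proof -
  let ?m = "jet_move k i \<eta>" and ?p = "fst (F \<eta>)" and ?d = "jet_partial k i F \<eta>"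
  define J where "J = {s. ?m s \<in> W}"
  have J: "open J" "0 \<in> J"
    unfolding J_def using open_jet_move assms by (auto simp: jet_move_0)
  have "((\<lambda>s. F (?m s)) has_vector_derivative ?d) (at 0)"
    using jet_smooth_on_has_vector_derivative[OF smooth_F, of k i \<eta> 0] assms by (simp add: jet_move_0)
  then have x: "((\<lambda>s. fst (F (?m s))) has_vector_derivative fst ?d) (at 0)"
    and "((\<lambda>s. snd (F (?m s))) has_vector_derivative snd ?d) (at 0)"
    by (auto intro: bounded_linear.has_vector_derivative bounded_linear_fst bounded_linear_snd)
  from bounded_linear.has_vector_derivative[OF bounded_linear_vec_nth[of 1] this(2)]
  have u: "((\<lambda>s. snd (F (?m s)) $ 1) has_real_derivative snd ?d $ 1) (at 0)"
    by (simp add: has_real_derivative_iff_has_vector_derivative)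
  have m: "((\<lambda>s. ?m s j) has_vector_derivative (if k = j then axis i 1 else 0)) (at 0)" for j
    by (cases "k = j") (auto simp: jet_move_apply intro!: derivative_eq_intros)
  have p: "fst (F (?m 0)) = ?p" "?p \<in> X"
    using state_of_jet(1)[OF assms] by (auto simp: jet_move_0)
  have "((\<lambda>s. \<phi> (fst (F (?m s)))) has_vector_derivative D\<phi> ?p (fst ?d)) (at 0)"
    using has_vector_derivative_frechet_compose[OF x, of \<phi>] p differentiable_\<phi> by simp
  from has_vector_derivative_unique_open[OF this m J] show "D\<phi> ?p (fst ?d) = (if k = 0 then axis i 1 else 0)"
    using state_of_jet(2) by (auto simp: J_def)
  have "((\<lambda>s. a (fst (F (?m s)))) has_vector_derivative Da ?p (fst ?d)) (at 0)"
    using has_vector_derivative_frechet_compose[OF x, of a] p differentiable_a by simp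
  from has_vector_derivative_scaleR[OF u this]
  have "((\<lambda>s. snd (F (?m s)) $ 1 *\<^sub>R a (fst (F (?m s)))) has_vector_derivative
      snd (F \<eta>) $ 1 *\<^sub>R Da ?p (fst ?d) + snd ?d $ 1 *\<^sub>R a ?p) (at 0)"
    by (simp add: jet_move_0)
  from has_vector_derivative_unique_open[OF m this J]
  show "(if k = 1 then axis i 1 else 0) = snd ?d $ 1 *\<^sub>R a ?p + snd (F \<eta>) $ 1 *\<^sub>R Da ?p (fst ?d)"
    using state_of_jet(3) by (auto simp: J_def)
qed

text \<open>Varying \<open>y\<close> shows that the derivative of \<phi> is onto. Varying
  \<open>y'\<close> moves the state inside the kernel of this derivative and expresses the axis
  vectors as \<open>transversal_on_kernel\<close> requires.\<close>

lemma transversal: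
  assumes "\<eta> \<in> W"
  shows "snd (F \<eta>) $ 1 \<noteq> 0"
    and "D\<phi> (fst (F \<eta>)) n = 0 \<Longrightarrow> n \<noteq> 0 \<Longrightarrow> cross2 (a (fst (F \<eta>))) (Da (fst (F \<eta>)) n) \<noteq> 0"
proof -
  have p: "fst (F \<eta>) \<in> X"
    by (rule state_of_jet(1)[OF assms])
  note * = transversal_on_kernel[where D = "D\<phi> (fst (F \<eta>))" and v = "\<lambda>i. fst (jet_partial 0 i F \<eta>)"
      and A = "Da (fst (F \<eta>))" and w = "\<lambda>i. fst (jet_partial 1 i F \<eta>)"
      and \<alpha> = "\<lambda>i. snd (jet_partial 1 i F \<eta>) $ 1" and a = "a (fst (F \<eta>))" and c = "snd (F \<eta>) $ 1",
      OF linear_frechet_derivative[OF differentiable_\<phi>[OF p]] _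
        linear_frechet_derivative[OF differentiable_a[OF p]]]
  show "snd (F \<eta>) $ 1 \<noteq> 0"
    using jet_partial_relations[OF assms, of 0] jet_partial_relations[OF assms, of 1] by (intro *(1)) simp_all
  show "cross2 (a (fst (F \<eta>))) (Da (fst (F \<eta>)) n) \<noteq> 0" if "D\<phi> (fst (F \<eta>)) n = 0" "n \<noteq> 0"
    using jet_partial_relations[OF assms, of 0] jet_partial_relations[OF assms, of 1] that by (intro *(2)) simp_all
qed

text \<open>Varying an entry of order at least 2 moves the state in the kernel of the derivative of
  \<phi> and keeps \<open>u\<^sup>1 a\<close> fixed to first order. Taking the determinant with
  \<open>a\<close> removes the variation of \<open>u\<^sup>1\<close>, and transversality leaves no
  variation of the state.\<close>

lemma higher_jet_partial_eq_0:
  assumes "\<eta> \<in> W" "k \<ge> 2"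
  shows "fst (jet_partial k i F \<eta>) = 0" "snd (jet_partial k i F \<eta>) $ 1 = 0"
proof -
  interpret cross2: bounded_bilinear cross2 by (rule bounded_bilinear_cross2)
  let ?p = "fst (F \<eta>)" and ?d = "jet_partial k i F \<eta>"
  have D: "D\<phi> ?p (fst ?d) = 0"
    and A: "0 = snd ?d $ 1 *\<^sub>R a ?p + snd (F \<eta>) $ 1 *\<^sub>R Da ?p (fst ?d)"
    using jet_partial_relations[OF assms(1), of k i] assms(2) by auto
  have "cross2 (a ?p) (snd ?d $ 1 *\<^sub>R a ?p + snd (F \<eta>) $ 1 *\<^sub>R Da ?p (fst ?d))
      = snd (F \<eta>) $ 1 * cross2 (a ?p) (Da ?p (fst ?d))"
    by (simp add: cross2.add_right cross2.scaleR_right)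
  then show d: "fst ?d = 0"
    using A transversal[OF assms(1)] D by (metis cross2.zero_right mult_eq_0_iff)
  have "linear (Da ?p)"
    using linear_frechet_derivative differentiable_a state_of_jet(1)[OF assms(1)] by blast
  then have "snd ?d $ 1 *\<^sub>R a ?p = 0"
    using A d by (simp add: linear_0)
  \<comment> \<open>If \<open>a\<close> vanished, transversality would leave the kernel of the
    derivative of \<phi> trivial, and varying \<open>y'\<close> could not produce an axis
    vector.\<close>
  moreover have "a ?p \<noteq> 0"
  proof
    assume "a ?p = 0"
    then have "axis 1 1 = snd (F \<eta>) $ 1 *\<^sub>R Da ?p (fst (jet_partial 1 1 F \<eta>))"
      and "D\<phi> ?p (fst (jet_partial 1 1 F \<eta>)) = 0"
      using jet_partial_relations[OF assms(1), of 1 1] by auto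
    then show False
      using transversal(2)[OF assms(1)] \<open>a ?p = 0\<close> \<open>linear (Da ?p)\<close>
      by (metis axis_eq_0_iff cross2.zero_left linear_0 scaleR_zero_right zero_neq_one)
  qed
  ultimately show "snd ?d $ 1 = 0"
    by simp
qed

text \<open>If \<open>g2\<close> vanished at the state of a jet, the second derivative of \<open>y\<close> would be constrained by
  the state and \<open>u\<^sup>1\<close>, which do not depend on it.\<close>

lemma g2_nonzero:
  assumes "\<eta> \<in> W"
  shows "g2 (fst (F \<eta>)) \<noteq> 0"
proof
  interpret cross2: bounded_bilinear cross2 by (rule bounded_bilinear_cross2)
  let ?p = "fst (F \<eta>)"
  assume g2: "g2 ?p = 0"
  have "cross2 (axis i 1) (a ?p) = 0" for i
  proof -
    \<comment> \<open>Only \<open>y''\<close> is varied, in direction \<open>i\<close>. The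
      derivatives of the state and of \<open>u\<^sup>1\<close> vanish throughout a ball of
      parameters, so both are constant there.\<close>
    let ?m = "jet_move 2 i \<eta>"
    obtain e where e: "e > 0" "ball 0 e \<subseteq> {s. ?m s \<in> W}"
      using openE[OF open_jet_move, of 0 2 i \<eta>] assms by (auto simp: jet_move_0)
    have F': "((\<lambda>s. F (?m s)) has_vector_derivative jet_partial 2 i F (?m s)) (at s)" if "s \<in> ball 0 e" for s
      using that e jet_smooth_on_has_vector_derivative[OF smooth_F] by blast
    have d: "fst (jet_partial 2 i F (?m s)) = 0" "snd (jet_partial 2 i F (?m s)) $ 1 = 0" if "s \<in> ball 0 e" for s
      using that e higher_jet_partial_eq_0[of "?m s" 2 i] by blast+
    have "((\<lambda>s. fst (F (?m s))) has_vector_derivative 0) (at s within ball 0 e)" if "s \<in> ball 0 e" for s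
      using bounded_linear.has_vector_derivative[OF bounded_linear_fst F'[OF that]] d(1)[OF that]
      by (metis has_vector_derivative_at_within)
    then obtain c where c: "\<And>s. s \<in> ball 0 e \<Longrightarrow> fst (F (?m s)) = c"
      by (rule has_vector_derivative_zero_constant[OF convex_ball]) blast+
    have "((\<lambda>s. snd (F (?m s)) $ 1) has_vector_derivative 0) (at s within ball 0 e)" if "s \<in> ball 0 e" for s
      using bounded_linear.has_vector_derivative[OF bounded_linear_vec_nth[of 1]
          bounded_linear.has_vector_derivative[OF bounded_linear_snd F'[OF that]]] d(2)[OF that]
      by (metis has_vector_derivative_at_within)
    then obtain c' where c': "\<And>s. s \<in> ball 0 e \<Longrightarrow> snd (F (?m s)) $ 1 = c'"
      by (rule has_vector_derivative_zero_constant[OF convex_ball]) blast+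
    define s where "s = e / 2"
    have s: "s \<noteq> 0" "s \<in> ball 0 e" "0 \<in> ball 0 e"
      using e(1) by (auto simp: s_def dist_norm)
    then have m: "?m s \<in> W"
      using e(2) by blast
    have p: "fst (F (?m s)) = ?p" "snd (F (?m s)) $ 1 = snd (F \<eta>) $ 1"
      using c[OF s(2)] c[OF s(3)] c'[OF s(2)] c'[OF s(3)] by (simp_all only: jet_move_0)
    \<comment> \<open>The second input may differ between the two jets, but it multiplies
      \<open>g2 = 0\<close>, so the velocity is the same. Subtracting the two instances of
      \<open>state_of_jet(4)\<close> leaves only the change of \<open>y''\<close>.\<close>
    have f: "driftless g1 g2 ?p (snd (F (?m s))) = driftless g1 g2 ?p (snd (F \<eta>))"
      using p g2 by (simp add: driftless_def)
    have "cross2 (\<eta> 2 + s *\<^sub>R axis i 1) (a ?p) = cross2 (\<eta> 2) (a ?p)"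
      using state_of_jet(4)[OF m] state_of_jet(4)[OF assms]
      unfolding p f by (simp add: jet_move_apply)
    then show ?thesis
      using s by (simp add: cross2.add_left cross2.scaleR_left)
  qed
  \<comment> \<open>A vector parallel to both axes is zero. Then transversality makes the kernel of
    the derivative of \<phi> trivial, which contradicts the effect of varying
    \<open>y'\<close>.\<close>
  from this[of 1] this[of 2] have "a ?p = 0"
    by (simp add: cross2_axis vec_eq_iff forall_2)
  then have *: "D\<phi> ?p n = 0 \<Longrightarrow> n = 0" for n
    using transversal(2)[OF assms, of n] by (auto simp: cross2.zero_left)
  have "fst (jet_partial 1 1 F \<eta>) = 0"
    using jet_partial_relations(1)[OF assms, of 1 1] by (intro *) simp
  then have "axis 1 1 = (0 :: real^2)"
    using jet_partial_relations(2)[OF assms, of 1 1] \<open>a ?p = 0\<close>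
      linear_0[OF linear_frechet_derivative[OF differentiable_a[OF state_of_jet(1)[OF assms]]]]
    by simp
  then show False
    by (simp add: axis_eq_0_iff)
qed

end

text \<open>The flatness map is taken around \<open>p\<close>. Because the Lie derivative of \<phi>
  along \<open>g2\<close> vanishes identically, the one along the bracket is minus the derivative of
  \<open>a\<close> along \<open>g2\<close>; and \<open>g2\<close> is a nonzero kernel vector, so
  transversality applies.\<close>

lemma x_flat_output_nondegenerate:
  fixes g1 g2 :: "real^3 \<Rightarrow> real^3" and \<phi> :: "real^3 \<Rightarrow> real^2"
  assumes X: "open X" and g: "smooth_on g1 X" "smooth_on g2 X"
    and flat: "x_flat_output (driftless g1 g2) \<phi> X"
    and g2: "\<forall>z\<in>X. lie_deriv g2 \<phi> z = 0"
    and p: "p \<in> X"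
  shows "g2 p \<noteq> 0" "cross2 (lie_deriv g1 \<phi> p) (lie_deriv (lie_bracket g1 g2) \<phi> p) \<noteq> 0"
    "\<exists>v. frechet_derivative \<phi> (at p) v = axis i 1"
proof -
  have \<phi>: "smooth_on \<phi> X"
    using flat by (simp add: x_flat_output_def)
  obtain U r W and F :: "(nat \<Rightarrow> real^2) \<Rightarrow> (real^3) \<times> (real^2)" and \<eta>
    where F: "U \<subseteq> X" "open W" "jet_order_le r F W" "jet_smooth_on F W"
    and \<eta>: "\<eta> \<in> W" "fst (F \<eta>) = p"
    and traj: "\<forall>J Y. open J \<and> curve_derivs J Y \<and> (\<forall>t\<in>J. (\<lambda>k. Y k t) \<in> W)
       \<longrightarrow> (let x = (\<lambda>t. fst (F (\<lambda>k. Y k t))); u = (\<lambda>t. snd (F (\<lambda>k. Y k t)))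
            in x ` J \<subseteq> U \<and> ode_solution_on (driftless g1 g2) J x u \<and> (\<forall>t\<in>J. \<phi> (x t) = Y 0 t))"
    using flat[unfolded x_flat_output_def, THEN conjunct2, rule_format, OF p]
    by (elim exE conjE bexE) (rule that; assumption)
  interpret flat_parametrization g1 g2 \<phi> X r W F
  proof (unfold_locales, goal_cases)
    case (8 J Y)
    then show ?case
      using traj[rule_format, of J Y] F(1) unfolding Let_def by blast
  qed (use X g \<phi> g2 F in auto)
  show "g2 p \<noteq> 0"
    using g2_nonzero[OF \<eta>(1)] \<eta> by simp
  moreover have "D\<phi> p (g2 p) = 0"
    using g2 p lie_deriv_frechet[OF differentiable_\<phi>[OF p], of g2] by simp
  ultimately have "cross2 (a p) (Da p (g2 p)) \<noteq> 0"
    using transversal(2)[OF \<eta>(1)] unfolding \<eta>(2) by blast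
  moreover have "lie_deriv g1 (lie_deriv g2 \<phi>) p = 0"
  proof -
    have "((\<lambda>z. lie_deriv g2 \<phi> z) has_derivative (\<lambda>_. 0)) (at p)"
      by (rule has_derivative_transform_within_open[OF has_derivative_const X p]) (use g2 in auto)
    then have "partial_deriv k (lie_deriv g2 \<phi>) p = 0" for k
      by (simp add: partial_derivI)
    then show ?thesis
      by (simp add: lie_deriv_def)
  qed
  then have "lie_deriv (lie_bracket g1 g2) \<phi> p = - Da p (g2 p)"
    using lie_deriv_lie_bracket[OF \<phi> X p] g X p lie_deriv_frechet[OF differentiable_a[OF p], of g2]
    by (simp add: smooth_on_differentiable)
  ultimately show "cross2 (lie_deriv g1 \<phi> p) (lie_deriv (lie_bracket g1 g2) \<phi> p) \<noteq> 0"
    by (simp add: cross2_def)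
  show "\<exists>v. frechet_derivative \<phi> (at p) v = axis i 1"
    using jet_partial_relations(1)[OF \<eta>(1), of 0 i] unfolding \<eta>(2) by auto
qed

section \<open>The costate on the singular arc\<close>

lemma partial_deriv_eq_0:
  assumes "open X" "z \<in> X" "\<forall>z\<in>X. f z = 0"
  shows "partial_deriv k f z = 0"
proof -
  have "(f has_derivative (\<lambda>_. 0)) (at z)"
    by (rule has_derivative_transform_within_open[OF has_derivative_const assms(1,2)]) (use assms(3) in auto)
  from partial_derivI[OF this] show ?thesis .
qed

text \<open>A covector pulled back along \<open>f\<close> sees a vector only through its image under
  the derivative of \<open>f\<close>; the sum on the right is that image in coordinates.\<close>

lemma pullback_apply:
  fixes A :: "real^'m^'p" and c :: "real^'p" and f :: "real^'n \<Rightarrow> real^'m"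
  assumes "\<And>k. l $ k = c \<bullet> (A *v partial_deriv k f z)"
  shows "l \<bullet> v = c \<bullet> (A *v (\<Sum>k\<in>UNIV. v $ k *\<^sub>R partial_deriv k f z))"
  by (simp add: inner_vec_def[of l] assms linear_sum[OF matrix_vector_mul_linear] inner_sum_right
      matrix_vector_mult_scaleR mult.commute)

text \<open>Cramer's rule.\<close>

lemma cross2_basis:
  assumes "cross2 a b \<noteq> 0"
  shows "v = (cross2 v b / cross2 a b) *\<^sub>R a + (cross2 a v / cross2 a b) *\<^sub>R b"
proof -
  have "cross2 a b *\<^sub>R v = cross2 v b *\<^sub>R a + cross2 a v *\<^sub>R b"
    by (simp add: vec_eq_iff forall_2 cross2_def algebra_simps)
  then have "v = (1 / cross2 a b) *\<^sub>R (cross2 v b *\<^sub>R a + cross2 a v *\<^sub>R b)"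
    using assms by (metis divide_self_if scaleR_one scaleR_scaleR times_divide_eq_left mult_1)
  then show ?thesis
    by (simp add: scaleR_add_right)
qed

text \<open>The bound gives \<open>m \<bullet> m' \<ge> - K * (m \<bullet> m)\<close>, so the
  squared norm weighted by \<open>exp (2 * K * t)\<close> is nondecreasing; as it is zero at
  \<open>b\<close>, it is zero at \<open>a\<close>.\<close>

lemma backward_gronwall:
  fixes m :: "real \<Rightarrow> real^'n"
  assumes "a \<le> b" "finite S" and cont: "continuous_on {a..b} m" and "m b = 0"
    and deriv: "\<And>t k. t \<in> {a<..<b} - S \<Longrightarrow> ((\<lambda>t. m t $ k) has_real_derivative m' t $ k) (at t)"
    and bound: "\<And>t. t \<in> {a<..<b} - S \<Longrightarrow> norm (m' t) \<le> K * norm (m t)"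
  shows "m a = 0"
proof -
  define N where "N t = exp (2 * K * t) * (\<Sum>k\<in>UNIV. m t $ k * m t $ k)" for t
  \<comment> \<open>The value 0 at the endpoints and exceptional times keeps \<open>N'\<close>
    nonnegative everywhere. The fundamental theorem tolerates these finitely many points since
    \<open>N\<close> is continuous.\<close>
  define N' where "N' t = (if t \<in> {a<..<b} - S
    then exp (2 * K * t) * (2 * K * (m t \<bullet> m t) + 2 * (m t \<bullet> m' t)) else 0)" for t
  have "(N has_vector_derivative N' t) (at t)" if t: "t \<in> {a<..<b} - S" for t
  proof -
    have "(N has_real_derivative exp (2 * K * t) * (\<Sum>k\<in>UNIV. m t $ k * m' t $ k + m' t $ k * m t $ k)
        + exp (2 * K * t) * (2 * K) * (\<Sum>k\<in>UNIV. m t $ k * m t $ k)) (at t)"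
      unfolding N_def
      by (intro DERIV_mult' DERIV_sum deriv t DERIV_chain2[OF DERIV_exp] DERIV_cmult_Id)
    moreover have "(\<Sum>k\<in>UNIV. m t $ k * m' t $ k + m' t $ k * m t $ k) = 2 * (m t \<bullet> m' t)"
      by (simp add: inner_vec_def sum_distrib_left mult.commute)
    moreover have "(\<Sum>k\<in>UNIV. m t $ k * m t $ k) = m t \<bullet> m t"
      by (simp add: inner_vec_def)
    ultimately show ?thesis
      using t by (simp add: N'_def has_real_derivative_iff_has_vector_derivative algebra_simps)
  qed
  moreover have "continuous_on {a..b} N"
    unfolding N_def by (intro continuous_intros cont)
  ultimately have "(N' has_integral N b - N a) {a..b}"
    using \<open>a \<le> b\<close> \<open>finite S\<close> by (intro fundamental_theorem_of_calculus_interior_strong)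
  moreover have "N' t \<ge> 0" for t
  proof (cases "t \<in> {a<..<b} - S")
    case True
    have "- (m t \<bullet> m' t) \<le> norm (m t) * norm (m' t)"
      using Cauchy_Schwarz_ineq2[of "m t" "m' t"] by linarith
    also have "\<dots> \<le> norm (m t) * (K * norm (m t))"
      using bound[OF True] by (rule mult_left_mono) simp
    also have "\<dots> = K * (m t \<bullet> m t)"
      by (simp add: power2_norm_eq_inner[symmetric] power2_eq_square)
    finally show ?thesis
      using True by (simp add: N'_def)
  next
    case False
    then show ?thesis
      by (simp only: N'_def if_False order_refl)
  qed
  ultimately have "N a \<le> N b"
    using has_integral_nonneg[of N' "N b - N a" "{a..b}"] by simp
  then have "exp (2 * K * a) * (m a \<bullet> m a) \<le> 0"
    using \<open>m b = 0\<close> by (simp add: N_def inner_vec_def)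
  then show ?thesis
    using inner_ge_zero[of "m a"] by (simp add: mult_le_0_iff)
qed

text \<open>The adjoint of a surjective derivative is injective. On the compact product of
  \<open>C\<close> with the unit sphere the norm therefore has a positive minimum, which serves as
  \<open>c\<close>; homogeneity extends the bound to all \<open>\<zeta>\<close>.\<close>

lemma pullback_bounded_below:
  fixes f :: "real^'n \<Rightarrow> real^'m"
  assumes C: "compact C" and P: "\<And>k. continuous_on C (partial_deriv k f)"
    and f: "\<And>z. z \<in> C \<Longrightarrow> f differentiable (at z)"
    and surj: "\<And>z i. z \<in> C \<Longrightarrow> \<exists>v. frechet_derivative f (at z) v = axis i 1"
  shows "\<exists>c>0. \<forall>z\<in>C. \<forall>\<zeta>. c * norm \<zeta> \<le> norm (\<chi> k. \<zeta> \<bullet> partial_deriv k f z)"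
proof (cases "C = {}")
  case True
  then show ?thesis by (intro exI[of _ 1]) auto
next
  case False
  let ?N = "\<lambda>z \<zeta>. norm (\<chi> k. \<zeta> \<bullet> partial_deriv k f z)"
  have cont: "continuous_on (C \<times> sphere 0 1) (\<lambda>q. ?N (fst q) (snd q))"
    by (intro continuous_on_norm continuous_on_vec_lambda continuous_on_inner continuous_on_snd continuous_on_id
        continuous_on_compose2[OF P continuous_on_fst[OF continuous_on_id]]) auto
  have "compact (C \<times> sphere (0 :: real^'m) 1)"
    using C by (intro compact_Times compact_sphere)
  moreover have "C \<times> sphere (0 :: real^'m) 1 \<noteq> {}"
    using False norm_axis_1[of "undefined :: 'm"] by (auto simp del: norm_axis_1)
  ultimately obtain q where q: "q \<in> C \<times> sphere 0 1"
    "\<forall>q'\<in>C \<times> sphere 0 1. ?N (fst q) (snd q) \<le> ?N (fst q') (snd q')"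
    using continuous_attains_inf[OF _ _ cont] by (elim meta_impE bexE) (assumption | rule that)+
  define z \<zeta> where "z = fst q" and "\<zeta> = snd q"
  have z: "z \<in> C" and \<zeta>: "norm \<zeta> = 1"
    using q(1) by (auto simp: z_def \<zeta>_def)
  \<comment> \<open>A covector orthogonal to all partial derivatives annihilates the range of the
    derivative, hence every axis vector.\<close>
  have pos: "?N z \<zeta> > 0"
  proof (rule ccontr)
    assume "\<not> ?N z \<zeta> > 0"
    then have 0: "\<zeta> \<bullet> partial_deriv k f z = 0" for k
      by (simp add: vec_eq_iff)
    have "\<zeta> \<bullet> frechet_derivative f (at z) v = 0" for v
      unfolding lie_deriv_frechet[OF f[OF z], of "\<lambda>_. v", symmetric]
      by (simp add: lie_deriv_def inner_sum_right 0)
    moreover have "\<exists>v. \<zeta> $ i = \<zeta> \<bullet> frechet_derivative f (at z) v" for i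
    proof -
      obtain v where "frechet_derivative f (at z) v = axis i 1"
        using surj[OF z] by blast
      then have "\<zeta> $ i = \<zeta> \<bullet> frechet_derivative f (at z) v"
        by (simp add: inner_axis)
      then show ?thesis by blast
    qed
    ultimately have "\<zeta> = 0"
      unfolding vec_eq_iff by (metis zero_index)
    then show False
      using \<zeta> by simp
  qed
  have "?N z \<zeta> * norm \<zeta>' \<le> ?N z' \<zeta>'" if "z' \<in> C" for z' \<zeta>'
  proof (cases "\<zeta>' = 0")
    case False
    define \<theta> where "\<theta> = (1 / norm \<zeta>') *\<^sub>R \<zeta>'"
    have \<theta>: "norm \<theta> = 1" "\<zeta>' = norm \<zeta>' *\<^sub>R \<theta>"
      using False by (simp_all add: \<theta>_def)
    have "(\<chi> k. \<zeta>' \<bullet> partial_deriv k f z') = norm \<zeta>' *\<^sub>R (\<chi> k. \<theta> \<bullet> partial_deriv k f z')"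
      by (subst \<theta>(2)) (simp add: vec_eq_iff)
    then have "?N z' \<zeta>' = norm \<zeta>' * ?N z' \<theta>"
      by simp
    moreover have "?N z \<zeta> \<le> ?N z' \<theta>"
      using q(2)[rule_format, of "(z', \<theta>)"] that \<theta>(1) by (simp add: z_def \<zeta>_def)
    ultimately show ?thesis
      by (simp add: mult.commute mult_left_mono)
  qed simp
  with pos show ?thesis
    by blast
qed

lemma sym_pos_def_matrix_inv:
  assumes "sym_pos_def M"
  shows "matrix_inv M ** M = mat 1"
proof -
  have "v = 0" if "M *v v = 0" for v
    using assms that by (metis inner_zero_right less_irrefl sym_pos_def_def)
  then have "invertible M"
    using matrix_left_invertible_ker[of M] by (auto simp: invertible_left_inverse)
  then show ?thesis
    unfolding invertible_def matrix_inv_def by (rule someI2_ex) blast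
qed

text \<open>For a pulled-back costate the derivatives of \<open>g1\<close> cancel against those
  inside the derivative of \<open>lie_deriv g1 \<phi>\<close>. What remains is the rate of change of
  \<open>partial_deriv k \<phi>\<close> along the trajectory.\<close>

lemma costate_rhs_on_arc:
  fixes \<phi> :: "real^'n \<Rightarrow> real^2"
  assumes X: "open X" "z \<in> X" and g: "smooth_on g1 X" "smooth_on g2 X" and \<phi>: "smooth_on \<phi> X"
    and g2: "\<forall>z\<in>X. lie_deriv g2 \<phi> z = 0"
    and MQ: "sym_pos_def M" "sym_pos_def Q"
    and l: "\<And>k. l $ k = track_err_rate g1 \<phi> yd T t z u \<bullet> (M *v partial_deriv k \<phi> z)"
  shows "- partial_deriv k (\<lambda>z. hamiltonian (driftless g1 g2) (track_running_cost g1 \<phi> yd T Q M) t z u l) z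
    = track_err \<phi> yd t z \<bullet> (Q *v partial_deriv k \<phi> z)
      + track_err_rate g1 \<phi> yd T t z u \<bullet> (M *v frechet_derivative (partial_deriv k \<phi>) (at z) (driftless g1 g2 z u))"
proof -
  let ?r = "track_err_rate g1 \<phi> yd T t z u"
  let ?S = "\<lambda>g. \<Sum>i\<in>UNIV. partial_deriv k g z $ i *\<^sub>R partial_deriv i \<phi> z"
  have diff: "g1 differentiable (at z)" "g2 differentiable (at z)" "\<phi> differentiable (at z)"
    "\<And>k. partial_deriv k \<phi> differentiable (at z)"
    using g \<phi> X by (auto intro: smooth_on_differentiable smooth_on_partial_deriv)
  \<comment> \<open>Differentiating the identity \<open>lie_deriv g2 \<phi> = 0\<close> trades the
    derivative of \<open>g2\<close> for a second derivative of \<phi>.\<close>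
  have "lie_deriv g2 (partial_deriv k \<phi>) z + ?S g2 = 0"
    using partial_deriv_lie_deriv[OF \<phi> X diff(2), of k] partial_deriv_eq_0[OF X g2] by simp
  then have S2: "?S g2 = - lie_deriv g2 (partial_deriv k \<phi>) z"
    by (simp add: eq_neg_iff_add_eq_0 add.commute)
  have lS: "l \<bullet> partial_deriv k g z = ?r \<bullet> (M *v ?S g)" for g :: "real^'n \<Rightarrow> real^'n"
    by (rule pullback_apply[OF l])
  have neg: "M *v (- v) = - (M *v v)" for v
    by (simp add: linear_neg[OF matrix_vector_mul_linear])
  show ?thesis
    unfolding costate_rhs_explicit[OF MQ diff(3) differentiable_lie_deriv[OF diff(1,4)] diff(1,2)]
      partial_deriv_lie_deriv[OF \<phi> X diff(1)] frechet_derivative_driftless[OF diff(4)]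
    by (simp add: inner_add_right lS S2 neg matrix_vector_right_distrib matrix_vector_mult_scaleR algebra_simps)
qed

text \<open>The three fields span: the images of \<open>g1\<close> and the bracket under the
  derivative of \<phi> form a basis of the plane, and \<open>g2\<close> spans the kernel. Hence
  \<open>w\<close> is a combination of vectors orthogonal to it.\<close>

lemma flat_output_controllable:
  fixes g1 g2 :: "real^3 \<Rightarrow> real^3" and \<phi> :: "real^3 \<Rightarrow> real^2"
  assumes X: "open X" and g: "smooth_on g1 X" "smooth_on g2 X"
    and flat: "x_flat_output (driftless g1 g2) \<phi> X"
    and g2: "\<forall>z\<in>X. lie_deriv g2 \<phi> z = 0"
    and p: "p \<in> X"
    and w: "w \<bullet> g1 p = 0" "w \<bullet> g2 p = 0" "w \<bullet> lie_bracket g1 g2 p = 0"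
  shows "w = 0"
proof -
  note nondeg = x_flat_output_nondegenerate[OF X g flat g2 p]
  let ?D = "frechet_derivative \<phi> (at p)" and ?b = "lie_bracket g1 g2 p"
  have \<phi>: "\<phi> differentiable (at p)"
    using flat X p by (auto simp: x_flat_output_def intro: smooth_on_differentiable)
  interpret linear ?D
    by (rule linear_frechet_derivative[OF \<phi>])
  have D: "?D (g1 p) = lie_deriv g1 \<phi> p" "?D (g2 p) = 0" "?D ?b = lie_deriv (lie_bracket g1 g2) \<phi> p"
    using g2 p by (simp_all flip: lie_deriv_frechet[OF \<phi>])
  obtain v where v: "\<And>i. ?D (v i) = axis i 1"
    using nondeg(3) by metis
  obtain \<alpha> \<beta> where "?D w = \<alpha> *\<^sub>R ?D (g1 p) + \<beta> *\<^sub>R ?D ?b"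
    using cross2_basis[OF nondeg(2), of "?D w"] D by metis
  then have "?D (w - \<alpha> *\<^sub>R g1 p - \<beta> *\<^sub>R ?b) = 0"
    by (simp add: diff scaleR)
  from kernel_line[OF linear_axioms v D(2) nondeg(1) this]
  obtain c where "w - \<alpha> *\<^sub>R g1 p - \<beta> *\<^sub>R ?b = c *\<^sub>R g2 p"
    by blast
  then have "w = \<alpha> *\<^sub>R g1 p + \<beta> *\<^sub>R ?b + c *\<^sub>R g2 p"
    by (simp add: algebra_simps)
  from arg_cong[OF this, of "inner w"] have "w \<bullet> w = 0"
    using w by (simp add: inner_add_right)
  then show ?thesis
    by simp
qed

text \<open>The pulled-back covector \<open>c\<close> has the same pairings as \<open>l\<close> with
  three spanning vectors; its pairing with \<open>g2\<close> is 0 because \<phi> is constant along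
  \<open>g2\<close>.\<close>

lemma costate_eq_pullback:
  fixes g1 g2 :: "real^3 \<Rightarrow> real^3" and \<phi> :: "real^3 \<Rightarrow> real^2"
  assumes X: "open X" and g: "smooth_on g1 X" "smooth_on g2 X"
    and flat: "x_flat_output (driftless g1 g2) \<phi> X"
    and g2: "\<forall>z\<in>X. lie_deriv g2 \<phi> z = 0"
    and p: "p \<in> X"
    and l: "l \<bullet> g1 p = r \<bullet> (M *v lie_deriv g1 \<phi> p)" "l \<bullet> g2 p = 0"
      "l \<bullet> lie_bracket g1 g2 p = r \<bullet> (M *v lie_deriv (lie_bracket g1 g2) \<phi> p)"
  shows "l $ k = r \<bullet> (M *v partial_deriv k \<phi> p)"
proof -
  define c :: "real^3" where "c = (\<chi> k. r \<bullet> (M *v partial_deriv k \<phi> p))"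
  have c: "c \<bullet> g p = r \<bullet> (M *v lie_deriv g \<phi> p)" for g
    unfolding lie_deriv_def by (rule pullback_apply) (simp add: c_def)
  have "l - c = 0"
    using X g flat g2 p by (rule flat_output_controllable) (use p g2 in \<open>simp_all add: inner_diff_left c l\<close>)
  then show ?thesis
    by (simp add: c_def)
qed

text \<open>This is where the condition on the weights enters: with
  \<open>\<zeta> = M r + Qbar e\<close>, the left side becomes linear in \<open>\<zeta>\<close>
  alone.\<close>

lemma weight_factorization:
  fixes Q Qbar M :: "real^'n^'n"
  assumes "sym_pos_def M" "Q = Qbar ** matrix_inv M ** Qbar"
  shows "Q *v e + Qbar *v r = (Qbar ** matrix_inv M) *v (M *v r + Qbar *v e)"
proof -
  have "(Qbar ** matrix_inv M) *v (M *v r) = Qbar *v ((matrix_inv M ** M) *v r)"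
    by (simp only: matrix_vector_mul_assoc matrix_mul_assoc)
  then show ?thesis
    using assms by (simp add: sym_pos_def_matrix_inv matrix_vector_right_distrib matrix_vector_mul_assoc)
qed

lemma continuous_on_compact_bound:
  fixes h :: "'k::finite \<Rightarrow> 'a::topological_space \<Rightarrow> 'b::real_normed_vector"
  assumes "compact C" "\<And>k. continuous_on C (h k)"
  obtains B where "\<And>k z. z \<in> C \<Longrightarrow> norm (h k z) \<le> B"
proof -
  have "\<exists>B. \<forall>z\<in>C. norm (h k z) \<le> B" for k
    using compact_imp_bounded[OF compact_continuous_image[OF assms(2,1)]] by (auto simp: bounded_iff)
  then obtain B where B: "\<And>k z. z \<in> C \<Longrightarrow> norm (h k z) \<le> B k"
    by metis
  have "norm (h k z) \<le> Max (range B)" if "z \<in> C" for k z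
    using B[OF that] by (meson Max_ge finite finite_imageI order_trans rangeI)
  then show ?thesis
    by (rule that)
qed

section \<open>The rate of the shifted costate\<close>

lemma inner_transpose_vector: "v \<bullet> (transpose A *v w) = (A *v v) \<bullet> w" for A :: "real^'n^'m"
  by (metis dot_lmul_matrix transpose_matrix_vector transpose_transpose)

text \<open>Ensures that the \<open>vector_derivative\<close> inside \<open>track_err_rate\<close>
  is a genuine derivative, one-sided at the ends of the horizon.\<close>

lemma smooth_curve_on_differentiable:
  assumes "smooth_curve_on J y" "t \<in> J"
  shows "(y has_vector_derivative vector_derivative y (at t within J)) (at t within J)"
proof -
  obtain Y where "curve_derivs J Y" "\<forall>t\<in>J. Y 0 t = y t"
    using assms(1) by (auto simp: smooth_curve_on_def)
  then have "(y has_vector_derivative Y (Suc 0) t) (at t within J)"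
    using assms(2) has_vector_derivative_transform[of t J y "Y 0"] by (simp add: curve_derivs_def)
  then show ?thesis
    using differentiableI_vector vector_derivative_works by blast
qed

text \<open>The costate equation and the product rule are added. The pulled-back form of
  \<open>l\<close> is inserted only on the right side at the time \<open>t\<close>, so
  \<open>r\<close>, which contains the input, is never differentiated.\<close>

lemma has_real_derivative_shifted_costate:
  fixes \<phi> :: "real^'n \<Rightarrow> real^2" and yd :: "real \<Rightarrow> real^2"
  defines "e \<equiv> \<lambda>t x. track_err \<phi> yd t x"
  assumes X: "open X" "x t \<in> X" and g: "smooth_on g1 X" "smooth_on g2 X" and \<phi>: "smooth_on \<phi> X"
    and g2: "\<forall>z\<in>X. lie_deriv g2 \<phi> z = 0"
    and pos_def: "sym_pos_def M" "sym_pos_def Q" "sym_pos_def Qbar" and Q: "Q = Qbar ** matrix_inv M ** Qbar"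
    and r: "r = track_err_rate g1 \<phi> yd T t (x t) (u t)"
    and x: "(x has_vector_derivative driftless g1 g2 (x t) (u t)) (at t within {0..T})"
    and yd: "smooth_curve_on {0..T} yd" and t: "t \<in> {0..T}"
    and l: "\<And>k. l t $ k = r \<bullet> (M *v partial_deriv k \<phi> (x t))"
    and dl: "((\<lambda>s. l s $ k) has_real_derivative
      - partial_deriv k (\<lambda>z. hamiltonian (driftless g1 g2) (track_running_cost g1 \<phi> yd T Q M) t z (u t) (l t)) (x t))
      (at t within {0..T})"
  shows "((\<lambda>s. l s $ k + e s (x s) \<bullet> (Qbar *v partial_deriv k \<phi> (x s))) has_real_derivative
      (M *v r + Qbar *v e t (x t)) \<bullet> (frechet_derivative (partial_deriv k \<phi>) (at (x t)) (driftless g1 g2 (x t) (u t))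
        + transpose (Qbar ** matrix_inv M) *v partial_deriv k \<phi> (x t))) (at t within {0..T})"
proof -
  let ?P = "partial_deriv k \<phi> (x t)"
  let ?P' = "frechet_derivative (partial_deriv k \<phi>) (at (x t)) (driftless g1 g2 (x t) (u t))"
  let ?e = "e t (x t)" and ?R = "Qbar ** matrix_inv M"
  have diff: "\<phi> differentiable (at (x t))" "partial_deriv k \<phi> differentiable (at (x t))"
    using \<phi> X by (auto intro: smooth_on_differentiable smooth_on_partial_deriv)
  \<comment> \<open>The tracking error has rate \<open>r\<close> because \<open>g2\<close> does not
    move \<phi>.\<close>
  have e': "((\<lambda>s. e s (x s)) has_vector_derivative r) (at t within {0..T})"
    using has_vector_derivative_diff[OF smooth_curve_on_differentiable[OF yd t]
        has_vector_derivative_frechet_compose[OF x diff(1)]] g2 X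
    by (simp add: e_def track_err_def r track_err_rate_def frechet_derivative_driftless[OF diff(1)])
  have "((\<lambda>s. Qbar *v partial_deriv k \<phi> (x s)) has_vector_derivative Qbar *v ?P') (at t within {0..T})"
    by (rule bounded_linear.has_vector_derivative[OF matrix_vector_mul_bounded_linear
          has_vector_derivative_frechet_compose[OF x diff(2)]])
  from bounded_bilinear.has_vector_derivative[OF bounded_bilinear_inner e' this]
  have "((\<lambda>s. e s (x s) \<bullet> (Qbar *v partial_deriv k \<phi> (x s))) has_real_derivative
      ?e \<bullet> (Qbar *v ?P') + r \<bullet> (Qbar *v ?P)) (at t within {0..T})"
    by (simp add: has_real_derivative_iff_has_vector_derivative)
  from DERIV_add[OF dl[unfolded costate_rhs_on_arc[OF X g \<phi> g2 pos_def(1,2) l[unfolded r]], folded r] this]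
  have "((\<lambda>s. l s $ k + e s (x s) \<bullet> (Qbar *v partial_deriv k \<phi> (x s))) has_real_derivative
      ?e \<bullet> (Q *v ?P) + r \<bullet> (M *v ?P') + (?e \<bullet> (Qbar *v ?P') + r \<bullet> (Qbar *v ?P))) (at t within {0..T})"
    by (simp add: e_def)
  moreover have "?e \<bullet> (Q *v ?P) + r \<bullet> (M *v ?P') + (?e \<bullet> (Qbar *v ?P') + r \<bullet> (Qbar *v ?P))
      = (Q *v ?e + Qbar *v r) \<bullet> ?P + (M *v r + Qbar *v ?e) \<bullet> ?P'"
    using pos_def by (simp add: sym_pos_def_def symmetric_dot inner_add_left)
  moreover have "(Q *v ?e + Qbar *v r) \<bullet> ?P = (M *v r + Qbar *v ?e) \<bullet> (transpose ?R *v ?P)"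
    unfolding inner_transpose_vector weight_factorization[OF pos_def(1) Q] ..
  ultimately show ?thesis
    by (simp add: inner_add_right add.commute)
qed

text \<open>The expression is affine in the input with coefficients continuous in the state, so it
  is bounded over a compact set of states and the box of admissible inputs.\<close>

lemma shifted_costate_rate_bound:
  fixes \<phi> :: "real^'n \<Rightarrow> real^2" and R :: "real^2^2"
  assumes X: "open X" and g: "smooth_on g1 X" "smooth_on g2 X" and \<phi>: "smooth_on \<phi> X"
    and C: "compact C" "C \<subseteq> X"
  obtains B where "\<And>k z v. z \<in> C \<Longrightarrow> \<forall>a. \<bar>v $ a\<bar> \<le> umax $ a \<Longrightarrow>
    norm (frechet_derivative (partial_deriv k \<phi>) (at z) (driftless g1 g2 z v) + R *v partial_deriv k \<phi> z) \<le> B"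
proof -
  have P: "partial_deriv k \<phi> differentiable (at z)" if "z \<in> X" for k z
    using that smooth_on_differentiable[OF smooth_on_partial_deriv[OF \<phi> X] X] by blast
  have cont_lie: "continuous_on C (lie_deriv g (partial_deriv k \<phi>))" if "smooth_on g X" for g k
  proof -
    have "lie_deriv g (partial_deriv k \<phi>) differentiable (at z)" if "z \<in> X" for z
      using that \<open>smooth_on g X\<close> X \<phi>
      by (intro differentiable_lie_deriv) (auto intro: smooth_on_differentiable smooth_on_partial_deriv)
    then have "continuous_on X (lie_deriv g (partial_deriv k \<phi>))"
      by (auto intro: continuous_at_imp_continuous_on differentiable_imp_continuous_within)
    then show ?thesis
      using C(2) continuous_on_subset by blast
  qed
  have "continuous_on C (partial_deriv k \<phi>)" for k
    using smooth_on_continuous[OF smooth_on_partial_deriv[OF \<phi> X] X] C(2) continuous_on_subset by blast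
  then have cont_R: "continuous_on C (\<lambda>z. R *v partial_deriv k \<phi> z)" for k
    by (rule bounded_linear.continuous_on[OF matrix_vector_mul_bounded_linear])
  obtain B1 where B1: "\<And>k z. z \<in> C \<Longrightarrow> norm (lie_deriv g1 (partial_deriv k \<phi>) z) \<le> B1"
    by (rule continuous_on_compact_bound[OF C(1), of "\<lambda>k. lie_deriv g1 (partial_deriv k \<phi>)"]) (use cont_lie[OF g(1)] in blast)+
  obtain B2 where B2: "\<And>k z. z \<in> C \<Longrightarrow> norm (lie_deriv g2 (partial_deriv k \<phi>) z) \<le> B2"
    by (rule continuous_on_compact_bound[OF C(1), of "\<lambda>k. lie_deriv g2 (partial_deriv k \<phi>)"]) (use cont_lie[OF g(2)] in blast)+
  obtain B3 where B3: "\<And>k z. z \<in> C \<Longrightarrow> norm (R *v partial_deriv k \<phi> z) \<le> B3"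
    by (rule continuous_on_compact_bound[OF C(1), of "\<lambda>k z. R *v partial_deriv k \<phi> z"]) (use cont_R in blast)+
  show ?thesis
  proof (rule that[of "umax $ 1 * B1 + umax $ 2 * B2 + B3"])
    fix k z and v :: "real^2"
    assume z: "z \<in> C" and v: "\<forall>a. \<bar>v $ a\<bar> \<le> umax $ a"
    have umax: "0 \<le> umax $ a" for a
      using v abs_ge_zero order_trans by blast
    have "norm (v $ 1 *\<^sub>R lie_deriv g1 (partial_deriv k \<phi>) z) \<le> umax $ 1 * B1"
      "norm (v $ 2 *\<^sub>R lie_deriv g2 (partial_deriv k \<phi>) z) \<le> umax $ 2 * B2"
      using v umax B1[OF z] B2[OF z] by (auto intro!: mult_mono)
    then show "norm (frechet_derivative (partial_deriv k \<phi>) (at z) (driftless g1 g2 z v) + R *v partial_deriv k \<phi> z)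
        \<le> umax $ 1 * B1 + umax $ 2 * B2 + B3"
      using z C(2) B3[OF z] unfolding frechet_derivative_driftless[OF P[OF subsetD[OF C(2) z]]]
      by (intro norm_triangle_mono) auto
  qed
qed

text \<open>The formula with \<open>Qbar\<close> is stated for arcs reaching the final time, since
  the transversality condition at \<open>T\<close> has to be carried back along the arc.\<close>

theorem mainTheorem1:
  fixes X :: "(real^3) set"
    and g1 g2 :: "real^3 \<Rightarrow> real^3"
    and \<phi> :: "real^3 \<Rightarrow> real^2"
    and yd :: "real \<Rightarrow> real^2"
    and Qbar Q M :: "real^2^2"
    and T :: real and x0 :: "real^3" and umax :: "real^2"
    and f :: "real^3 \<Rightarrow> real^2 \<Rightarrow> real^3"
    and run :: "real \<Rightarrow> real^3 \<Rightarrow> real^2 \<Rightarrow> real" and endcost :: "real^3 \<Rightarrow> real"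
    and x l :: "real \<Rightarrow> real^3" and u :: "real \<Rightarrow> real^2"
    and Is :: "real set"
  assumes "open X"
    and "smooth_on g1 X" and "smooth_on g2 X"
    and "f = driftless g1 g2"
    and "x_flat_output f \<phi> X"
    and "\<forall>z\<in>X. lie_deriv g2 \<phi> z = 0"
    and "T > 0" and "smooth_curve_on {0..T} yd"
    and "sym_pos_def Qbar" and "sym_pos_def Q" and "sym_pos_def M"
    and "Q = Qbar ** matrix_inv M ** Qbar"
    and "run = track_running_cost g1 \<phi> yd T Q M"
    and "endcost = track_terminal_cost \<phi> yd T Qbar"
    and "optimal_process f run endcost X x0 T umax x u"
    and "pmp_costate f run endcost T umax x u l"
    and "singular_arc g1 g2 \<phi> yd T Q M x u l Is"
  shows "\<forall>t\<in>Is. \<forall>k.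
           l t $ k = track_err_rate g1 \<phi> yd T t (x t) (u t) \<bullet> (M *v partial_deriv k \<phi> (x t)) \<and>
           (T \<in> closure Is \<longrightarrow>
             l t $ k = - (track_err \<phi> yd t (x t) \<bullet> (Qbar *v partial_deriv k \<phi> (x t))))"
proof -
  have X: "open X" and g: "smooth_on g1 X" "smooth_on g2 X" and f: "f = driftless g1 g2"
    and flat: "x_flat_output f \<phi> X" and g2: "\<forall>z\<in>X. lie_deriv g2 \<phi> z = 0"
    and T: "T > 0" and yd: "smooth_curve_on {0..T} yd"
    and pos_def: "sym_pos_def Qbar" "sym_pos_def Q" "sym_pos_def M" and Q: "Q = Qbar ** matrix_inv M ** Qbar"
    and run: "run = track_running_cost g1 \<phi> yd T Q M" and endcost: "endcost = track_terminal_cost \<phi> yd T Qbar"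
    and adm: "admissible_process f X x0 T umax x u" and pmp: "pmp_costate f run endcost T umax x u l"
    and arc: "singular_arc g1 g2 \<phi> yd T Q M x u l Is"
    using assms by (auto simp: optimal_process_def)
  have \<phi>: "smooth_on \<phi> X"
    using flat by (simp add: x_flat_output_def)
  let ?P = "\<lambda>k. partial_deriv k \<phi>"
  define r where "r t = track_err_rate g1 \<phi> yd T t (x t) (u t)" for t
  define e where "e t = track_err \<phi> yd t (x t)" for t
  have Is: "is_interval Is" "Is \<subseteq> {0..T}"
    using arc by (auto simp: singular_arc_def)
  have xX: "x t \<in> X" if "t \<in> {0..T}" for t
    using adm that by (auto simp: admissible_process_def)

  \<comment> \<open>At each time of the arc the three scalar conditions determine the costate
    algebraically.\<close>
  have l: "l t $ k = r t \<bullet> (M *v ?P k (x t))" if t: "t \<in> Is" for t k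
  proof -
    have "- (r t \<bullet> (M *v lie_deriv g1 \<phi> (x t))) + l t \<bullet> g1 (x t) = 0" "l t \<bullet> g2 (x t) = 0"
      "- (r t \<bullet> (M *v lie_deriv (lie_bracket g1 g2) \<phi> (x t))) + l t \<bullet> lie_bracket g1 g2 (x t) = 0"
      using arc t unfolding singular_arc_def Let_def switching_fun_explicit[OF pos_def(3)] r_def by blast+
    then show ?thesis
      using xX Is(2) t by (intro costate_eq_pullback[OF X g flat[unfolded f] g2]) auto
  qed

  have "l t $ k = - (e t \<bullet> (Qbar *v ?P k (x t)))" if closure: "T \<in> closure Is" and t: "t \<in> Is" for t k
  proof -
    \<comment> \<open>The claim is \<open>m t = 0\<close>. Unlike \<open>\<zeta>\<close>, which
      contains the input and may jump, \<open>m\<close> is continuous on the whole horizon.\<close>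
    define m where "m t = (\<chi> k. l t $ k + e t \<bullet> (Qbar *v ?P k (x t)))" for t
    define R where "R = Qbar ** matrix_inv M"
    define \<zeta> where "\<zeta> t = M *v r t + Qbar *v e t" for t
    define V where "V k t = frechet_derivative (?P k) (at (x t)) (driftless g1 g2 (x t) (u t))
      + transpose R *v ?P k (x t)" for k t
    define C where "C = x ` {0..T}"
    have cont_x: "continuous_on {0..T} x" and C_X: "C \<subseteq> X" and u: "\<And>t. t \<in> {0..T} \<Longrightarrow> \<forall>a. \<bar>u t $ a\<bar> \<le> umax $ a"
      using adm by (auto simp: admissible_process_def C_def)
    have C: "compact C"
      unfolding C_def using cont_x by (intro compact_continuous_image) auto
    obtain S1 where S1: "finite S1"
      "\<And>t. t \<in> {0..T} - S1 \<Longrightarrow> (x has_vector_derivative driftless g1 g2 (x t) (u t)) (at t within {0..T})"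
      using adm by (auto simp: admissible_process_def f)
    obtain S2 where S2: "finite S2"
      "\<And>t k. t \<in> {0..T} - S2 \<Longrightarrow> ((\<lambda>s. l s $ k) has_real_derivative
        - partial_deriv k (\<lambda>z. hamiltonian f run t z (u t) (l t)) (x t)) (at t within {0..T})"
      using pmp unfolding pmp_costate_def by blast
    have cont_P: "continuous_on X (?P k)" for k
      using smooth_on_continuous[OF smooth_on_partial_deriv[OF \<phi> X] X] .
    \<comment> \<open>This controls \<open>\<zeta>\<close> by \<open>m\<close> uniformly along the
      trajectory, which turns a bound by \<open>norm \<zeta>\<close> into one by
      \<open>norm m\<close>.\<close>
    have "\<exists>c>0. \<forall>z\<in>C. \<forall>\<zeta>. c * norm \<zeta> \<le> norm (\<chi> k. \<zeta> \<bullet> ?P k z)"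
    proof (rule pullback_bounded_below[OF C])
      show "continuous_on C (?P k)" for k
        by (rule continuous_on_subset[OF cont_P C_X])
      show "\<phi> differentiable (at z)" "\<exists>v. frechet_derivative \<phi> (at z) v = axis i 1" if "z \<in> C" for z i
        using that C_X smooth_on_differentiable[OF \<phi> X]
          x_flat_output_nondegenerate(3)[OF X g flat[unfolded f] g2] by blast+
    qed
    then obtain c where c: "c > 0" "\<And>z \<zeta>. z \<in> C \<Longrightarrow> c * norm \<zeta> \<le> norm (\<chi> k. \<zeta> \<bullet> ?P k z)"
      by blast
    obtain B where B0: "\<And>k z v. z \<in> C \<Longrightarrow> \<forall>a. \<bar>v $ a\<bar> \<le> umax $ a \<Longrightarrow>
        norm (frechet_derivative (?P k) (at z) (driftless g1 g2 z v) + transpose R *v ?P k z) \<le> B"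
      by (rule shifted_costate_rate_bound[OF X g \<phi> C C_X, of umax "transpose R"]) blast
    have B: "norm (V k t) \<le> B" if "t \<in> {0..T}" for k t
      unfolding V_def by (rule B0[OF _ u[OF that]]) (use that in \<open>simp add: C_def\<close>)
    \<comment> \<open>\<open>T\<close> itself need not belong to the arc; it suffices that an
      interval accumulating at \<open>T\<close> contains all times strictly between \<open>t\<close>
      and \<open>T\<close>.\<close>
    have between: "s \<in> Is" if s: "t < s" "s < T" for s
    proof -
      have "\<exists>q\<in>Is. dist q T < T - s"
        using closure s(2) unfolding closure_approachable by simp
      then obtain q where "q \<in> Is" "dist q T < T - s"
        by blast
      then show ?thesis
        using mem_is_interval_1_I[OF Is(1) t, of q s] s by (auto simp: dist_real_def)
    qed
    have m_\<zeta>: "m s = (\<chi> k. \<zeta> s \<bullet> ?P k (x s))" if "s \<in> Is" for s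
      using pos_def l[OF that] by (simp add: m_def \<zeta>_def sym_pos_def_def symmetric_dot inner_add_left vec_eq_iff)
    have "m t = 0"
    \<comment> \<open>Each of the three components of the rate is at most
      \<open>B * norm \<zeta>\<close>, and \<open>norm \<zeta> \<le> norm m / c\<close>; this gives
      the constant.\<close>
    proof (rule backward_gronwall[of t T "S1 \<union> S2" m "\<lambda>s. \<chi> k. \<zeta> s \<bullet> V k s" "CARD(3) * B / c"])
      show "t \<le> T" "finite (S1 \<union> S2)"
        using t Is S1 S2 by auto
      have P_x: "continuous_on {0..T} (\<lambda>s. ?P k (x s))" for k
        using continuous_on_compose2[OF cont_P cont_x] C_X unfolding C_def by blast
      have \<phi>_x: "continuous_on {0..T} (\<lambda>s. \<phi> (x s))"
        using continuous_on_compose2[OF smooth_on_continuous[OF \<phi> X] cont_x] C_X unfolding C_def by blast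
      have cont_yd: "continuous_on {0..T} yd"
        unfolding continuous_on_eq_continuous_within
        using smooth_curve_on_differentiable[OF yd] has_vector_derivative_continuous by blast
      have cont_l: "continuous_on {0..T} l"
        using pmp unfolding pmp_costate_def by blast
      have "continuous_on {0..T} (\<lambda>s. l s $ k + e s \<bullet> (Qbar *v ?P k (x s)))" for k
        unfolding e_def track_err_def
        by (rule continuous_on_add[OF continuous_on_component[OF cont_l]
              continuous_on_inner[OF continuous_on_diff[OF cont_yd \<phi>_x]
                bounded_linear.continuous_on[OF matrix_vector_mul_bounded_linear P_x]]])
      then have "continuous_on {0..T} m"
        unfolding m_def by (rule continuous_on_vec_lambda)
      then show "continuous_on {t..T} m"
        by (rule continuous_on_subset) (use t Is in auto)
      \<comment> \<open>This is the transversality condition, taken from the maximum principle at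
        \<open>T\<close>; continuity of \<open>m\<close> connects it to the arc.\<close>
      show "m T = 0"
      proof -
        have "T \<in> {0..T}"
          using T by simp
        then have "partial_deriv k (track_terminal_cost \<phi> yd T Qbar) (x T) = - (e T \<bullet> (Qbar *v ?P k (x T)))" for k
          unfolding e_def by (rule terminal_costate_explicit[OF pos_def(1) smooth_on_differentiable[OF \<phi> X xX]])
        moreover have "l T $ k = partial_deriv k endcost (x T)" for k
          using pmp unfolding pmp_costate_def by blast
        ultimately have "l T $ k = - (e T \<bullet> (Qbar *v ?P k (x T)))" for k
          by (simp only: endcost)
        then show ?thesis
          by (simp add: m_def vec_eq_iff)
      qed
    next
      fix s k assume s: "s \<in> {t<..<T} - (S1 \<union> S2)"
      \<comment> \<open>Interior times are singled out to turn derivatives within the horizon into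
        two-sided ones.\<close>
      then have s': "s \<in> Is" "s \<in> interior {0..T}" "s \<in> {0..T} - S1" "s \<in> {0..T} - S2"
        using between subsetD[OF Is(2) t] by (simp_all add: interior_atLeastAtMost_real)
      then have s_T: "s \<in> {0..T}"
        by blast
      show "((\<lambda>s. m s $ k) has_real_derivative (\<chi> k. \<zeta> s \<bullet> V k s) $ k) (at s)"
        using has_real_derivative_shifted_costate[where x = x and t = s and l = l and u = u and k = k,
            OF X xX[OF s_T] g \<phi> g2 pos_def(3,2,1) Q r_def S1(2)[OF s'(3)] yd s_T
            l[OF s'(1)] S2(2)[OF s'(4), unfolded f run]]
        unfolding at_within_interior[OF s'(2)] m_def V_def R_def \<zeta>_def e_def by simp
    next
      fix s assume "s \<in> {t<..<T} - (S1 \<union> S2)"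
      then have s: "s \<in> Is" "s \<in> {0..T}"
        using between subsetD[OF Is(2) t] by simp_all
      have "norm (\<chi> k. \<zeta> s \<bullet> V k s) \<le> (\<Sum>k\<in>UNIV. \<bar>\<zeta> s \<bullet> V k s\<bar>)"
        using norm_le_l1_cart[of "\<chi> k. \<zeta> s \<bullet> V k s"] by simp
      also have "\<dots> \<le> (\<Sum>k\<in>(UNIV :: 3 set). norm (\<zeta> s) * B)"
        using B[OF s(2)] by (intro sum_mono order_trans[OF Cauchy_Schwarz_ineq2] mult_left_mono) auto
      also have "\<dots> = CARD(3) * B * norm (\<zeta> s)"
        by simp
      also have "\<dots> \<le> CARD(3) * B * (norm (m s) / c)"
      proof (rule mult_left_mono)
        show "norm (\<zeta> s) \<le> norm (m s) / c"
          using c(2)[of "x s" "\<zeta> s"] s c(1) by (simp add: m_\<zeta> C_def pos_le_divide_eq mult.commute)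
        show "0 \<le> CARD(3) * B"
          using order_trans[OF norm_ge_zero B[OF s(2)]] by simp
      qed
      finally show "norm (\<chi> k. \<zeta> s \<bullet> V k s) \<le> CARD(3) * B / c * norm (m s)"
        by simp
    qed
    then show ?thesis
      by (simp add: m_def vec_eq_iff eq_neg_iff_add_eq_0)
  qed
  with l show ?thesis
    by (simp add: r_def e_def)
qed

end
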